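(* Let $P$ be a right LCM semigroup with identity, and let $\mathcal{S}$ be the inverse semigroup associated to $P$. Then the tight groupoid $\mathcal{G}_{\text{tight}}(\mathcal{S})$ is Hausdorff if and only if $P$ satisfies the following condition (H): for every $p,q\in P$ for which there exists some $b\in P$ with $pb=qb$, there is a finite set $F\subset P$ such that $pf=qf$ for all $f\in F$ and, whenever $b\in P$ satisfies $pb=qb$, there is an $f\in F$ such that $fP\cap bP\neq\emptyset$.
   Context: All semigroups are countable and discrete. A semigroup $P$ is left cancellative if $pq=ps$ implies $q=s$. A principal right ideal is a set $pP=\{pq\mid q\in P\}$. $P$ is a right LCM semigroup if it is left cancellative and the intersection of any two principal right ideals is either empty or another principal right ideal. Write $1_P$ for the identity and $U(P)$ for the group of invertible elements of $P$. Inverse semigroup $\mathcal{S}$: define $(p,q)\sim(a,b)$ on $P\times P$ iff there is $u\in U(P)$ with $au=p$ and $bu=q$; let $[p,q]$ be the class of $(p,q)$. Then $\mathcal{S}=\{[p,q]\mid p,q\in P\}\cup\{0\}$ is an inverse semigroup with zero $0$ and identity $[1_P,1_P]$, with product $[a,b][c,d]=[ab',dc']$ if $cP\cap bP=rP$ and $cc'=bb'=r$, and $[a,b][c,d]=0$ if $cP\cap bP=\emptyset$. One has $[a,b]^*=[b,a]$ and the idempotents are $E(\mathcal{S})=\{[a,a]\mid a\in P\}\cup\{0\}$. Tight groupoid: let $S$ be an inverse semigroup with zero, with idempotent semilattice $E(S)$ and natural order $s\leqslant t\iff s=ts^*s$. A filter in $E(S)$ is a nonempty proper subset $\xi\subset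 E(S)$ closed under products and upwards closed. Ultrafilters are maximal filters. The set of filters has the subspace topology from $\{0,1\}^{E(S)}$; $\widehat E_{\text{tight}}(S)$ is the closure of the set of ultrafilters in the space of filters. For $e\in E(S)$ let $D_e=\{\xi\in\widehat E_{\text{tight}}(S)\mid e\in\xi\}$, and for $s\in S$ let $\theta_s:D_{s^*s}\to D_{ss^*}$ send $\xi$ to the upwards closure of $\{ses^*\mid e\in\xi\}$; this is an action of $S$. $\mathcal{G}_{\text{tight}}(S)$ is its groupoid of germs: the set of classes $[s,x]$ of pairs $(s,x)$ with $s\in S$, $x\in D_{s^*s}$, where $(s,x)\sim(t,y)$ iff $x=y$ and there is $e\in E(S)$ with $x\in D_e$ and $se=te$; $d([s,x])=x$, $r([s,x])=\theta_s(x)$, $[s,x]^{-1}=[s^*,\theta_s(x)]$, $[t,\theta_s(x)][s,x]=[ts,x]$; the topology has basis the sets $\{[s,x]\mid x\in U\}$ for $s\in S$, $U\subset D_{s^*s}$ open. Its unit space is identified with $\widehat E_{\text{tight}}(S)$. *)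

theory Defs
  imports "HOL-Algebra.Group" "HOL-Analysis.Analysis"
begin

section \<open>Inverse semigroups with zero and their tight groupoids\<close>

record 's semigroup0 = "'s partial_object" +
  sprod :: "'s \<Rightarrow> 's \<Rightarrow> 's" (infixl \<open>\<cdot>\<index>\<close> 70)
  szero :: 's

text \<open>The definitions below are meant for inverse semigroups with zero, where every element \<open>s\<close> has
  exactly one inverse in the sense of \<open>star\<close>.\<close>

definition star :: "('s, 'm) semigroup0_scheme \<Rightarrow> 's \<Rightarrow> 's" where
  "star S s = (THE t. t \<in> carrier S \<and> s \<cdot>\<^bsub>S\<^esub> t \<cdot>\<^bsub>S\<^esub> s = s \<and> t \<cdot>\<^bsub>S\<^esub> s \<cdot>\<^bsub>S\<^esub> t = t)"

definition idems :: "('s, 'm) semigroup0_scheme \<Rightarrow> 's set" where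
  "idems S = {e \<in> carrier S. e \<cdot>\<^bsub>S\<^esub> e = e}"

definition nat_le :: "('s, 'm) semigroup0_scheme \<Rightarrow> 's \<Rightarrow> 's \<Rightarrow> bool" where
  "nat_le S s t \<longleftrightarrow> s = t \<cdot>\<^bsub>S\<^esub> star S s \<cdot>\<^bsub>S\<^esub> s"

definition filters :: "('s, 'm) semigroup0_scheme \<Rightarrow> 's set set" where
  "filters S = {\<xi>. \<xi> \<noteq> {} \<and> \<xi> \<subset> idems S \<and>
     (\<forall>e\<in>\<xi>. \<forall>f\<in>\<xi>. e \<cdot>\<^bsub>S\<^esub> f \<in> \<xi>) \<and>
     (\<forall>e\<in>\<xi>. \<forall>f\<in>idems S. nat_le S e f \<longrightarrow> f \<in> \<xi>)}"

definition ultrafilters :: "('s, 'm) semigroup0_scheme \<Rightarrow> 's set set" where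
  "ultrafilters S = {\<xi> \<in> filters S. \<forall>\<eta>\<in>filters S. \<xi> \<subseteq> \<eta> \<longrightarrow> \<eta> = \<xi>}"

text \<open>The subspace topology inherited from $\{0,1\}^{E(S)}$: a filter is identified with its
  characteristic function on the idempotents, and the product topology is pulled back along
  this injection.\<close>

definition filter_space :: "('s, 'm) semigroup0_scheme \<Rightarrow> 's set topology" where
  "filter_space S = pullback_topology (filters S) (\<lambda>\<xi>. \<lambda>e\<in>idems S. e \<in> \<xi>)
     (product_topology (\<lambda>_. discrete_topology (UNIV :: bool set)) (idems S))"

definition tight_filters :: "('s, 'm) semigroup0_scheme \<Rightarrow> 's set set" where
  "tight_filters S = filter_space S closure_of ultrafilters S"

definition tight_space :: "('s, 'm) semigroup0_scheme \<Rightarrow> 's set topology" where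
  "tight_space S = subtopology (filter_space S) (tight_filters S)"

definition D_set :: "('s, 'm) semigroup0_scheme \<Rightarrow> 's \<Rightarrow> 's set set" where
  "D_set S e = {\<xi> \<in> tight_filters S. e \<in> \<xi>}"

definition theta :: "('s, 'm) semigroup0_scheme \<Rightarrow> 's \<Rightarrow> 's set \<Rightarrow> 's set" where
  "theta S s \<xi> = {f \<in> idems S. \<exists>e\<in>\<xi>. nat_le S (s \<cdot>\<^bsub>S\<^esub> e \<cdot>\<^bsub>S\<^esub> star S s) f}"

definition germ_pairs :: "('s, 'm) semigroup0_scheme \<Rightarrow> ('s \<times> 's set) set" where
  "germ_pairs S = {(s, x). s \<in> carrier S \<and> x \<in> D_set S (star S s \<cdot>\<^bsub>S\<^esub> s)}"

definition germ_rel :: "('s, 'm) semigroup0_scheme \<Rightarrow> (('s \<times> 's set) \<times> ('s \<times> 's set)) set" where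
  "germ_rel S = {((s, x), (t, y)). (s, x) \<in> germ_pairs S \<and> (t, y) \<in> germ_pairs S \<and> x = y \<and>
     (\<exists>e\<in>idems S. x \<in> D_set S e \<and> s \<cdot>\<^bsub>S\<^esub> e = t \<cdot>\<^bsub>S\<^esub> e)}"

definition germ :: "('s, 'm) semigroup0_scheme \<Rightarrow> 's \<Rightarrow> 's set \<Rightarrow> ('s \<times> 's set) set" where
  "germ S s x = germ_rel S `` {(s, x)}"

text \<open>The set of arrows is the underlying set of the topology \<open>arrows\<close>. Units are not literally
  arrows: the unit space is given as a separate space, with which it is identified; \<open>gcomp h g\<close> is the product \<open>hg\<close>, relevant only when
  \<open>src h = rng g\<close>.\<close>

record ('g, 'x) top_groupoid =
  arrows :: "'g topology"
  units :: "'x topology"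
  src :: "'g \<Rightarrow> 'x"
  rng :: "'g \<Rightarrow> 'x"
  ginv :: "'g \<Rightarrow> 'g"
  gcomp :: "'g \<Rightarrow> 'g \<Rightarrow> 'g"

text \<open>The generating sets of the topology already form a basis. Source, range, inverse and product
  are read off from arbitrary representatives of a germ.\<close>

definition tight_groupoid ::
  "('s, 'm) semigroup0_scheme \<Rightarrow> (('s \<times> 's set) set, 's set) top_groupoid" where
  "tight_groupoid S = \<lparr>
     arrows = topology_generated_by
       {germ S s ` U | s U. s \<in> carrier S \<and> U \<subseteq> D_set S (star S s \<cdot>\<^bsub>S\<^esub> s) \<and> openin (tight_space S) U},
     units = tight_space S,
     src = (\<lambda>g. THE x. \<exists>s. (s, x) \<in> g),
     rng = (\<lambda>g. THE y. \<exists>s x. (s, x) \<in> g \<and> y = theta S s x),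
     ginv = (\<lambda>g. THE k. \<exists>s x. (s, x) \<in> g \<and> k = germ S (star S s) (theta S s x)),
     gcomp = (\<lambda>h g. THE k. \<exists>t s x. (t, theta S s x) \<in> h \<and> (s, x) \<in> g \<and> k = germ S (t \<cdot>\<^bsub>S\<^esub> s) x)\<rparr>"

definition Hausdorff_groupoid :: "('g, 'x) top_groupoid \<Rightarrow> bool" where
  "Hausdorff_groupoid G \<longleftrightarrow> Hausdorff_space (arrows G)"


section \<open>Right LCM semigroups with identity and their inverse semigroups\<close>

definition principal_right_ideal :: "('a, 'm) monoid_scheme \<Rightarrow> 'a \<Rightarrow> 'a set" where
  "principal_right_ideal P p = {p \<otimes>\<^bsub>P\<^esub> q | q. q \<in> carrier P}"

locale right_LCM_monoid = monoid P for P (structure) +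
  assumes left_cancel:
      "\<lbrakk>p \<in> carrier P; q \<in> carrier P; s \<in> carrier P; p \<otimes> q = p \<otimes> s\<rbrakk> \<Longrightarrow> q = s"
    and right_LCM:
      "\<lbrakk>p \<in> carrier P; q \<in> carrier P\<rbrakk> \<Longrightarrow>
         principal_right_ideal P p \<inter> principal_right_ideal P q = {} \<or>
         (\<exists>r\<in>carrier P. principal_right_ideal P p \<inter> principal_right_ideal P q
                          = principal_right_ideal P r)"

definition pair_rel :: "('a, 'm) monoid_scheme \<Rightarrow> (('a \<times> 'a) \<times> ('a \<times> 'a)) set" where
  "pair_rel P = {((p, q), (a, b)). p \<in> carrier P \<and> q \<in> carrier P \<and> a \<in> carrier P \<and> b \<in> carrier P \<and>
     (\<exists>u\<in>Units P. a \<otimes>\<^bsub>P\<^esub> u = p \<and> b \<otimes>\<^bsub>P\<^esub> u = q)}"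

definition pair_class :: "('a, 'm) monoid_scheme \<Rightarrow> 'a \<Rightarrow> 'a \<Rightarrow> ('a \<times> 'a) set" where
  "pair_class P p q = pair_rel P `` {(p, q)}"

text \<open>Classes of pairs are nonempty sets, so the empty set serves as the adjoined zero.
  In the product, all choices of representatives \<open>(a,b)\<close>, \<open>(c,d)\<close> and of \<open>b'\<close>, \<open>c'\<close> give the
  same class; if there are no such \<open>b'\<close>, \<open>c'\<close> (that is, the principal right ideals of \<open>b\<close> and
  \<open>c\<close> are disjoint) or one of the factors is zero, the union is empty, i.e.\ zero.\<close>

definition lcm_inverse_semigroup :: "('a, 'm) monoid_scheme \<Rightarrow> ('a \<times> 'a) set semigroup0" where
  "lcm_inverse_semigroup P = \<lparr>
     carrier = {pair_class P p q | p q. p \<in> carrier P \<and> q \<in> carrier P} \<union> {{}},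
     sprod = (\<lambda>X Y. \<Union> {pair_class P (a \<otimes>\<^bsub>P\<^esub> b') (d \<otimes>\<^bsub>P\<^esub> c') | a b c d b' c'.
        (a, b) \<in> X \<and> (c, d) \<in> Y \<and> b' \<in> carrier P \<and> c' \<in> carrier P \<and>
        (\<exists>r\<in>carrier P. principal_right_ideal P c \<inter> principal_right_ideal P b
                          = principal_right_ideal P r \<and>
                        c \<otimes>\<^bsub>P\<^esub> c' = r \<and> b \<otimes>\<^bsub>P\<^esub> b' = r)}),
     szero = {}\<rparr>"

end

theory Submission
  imports Defs
begin

text \<open>
  The element \<open>[p,q]\<close> of the inverse semigroup behaves like the partial injection \<open>q x \<mapsto> p x\<close> of \<open>P\<close>, and
  its nonzero idempotents \<open>[a,a]\<close> like the principal right ideals \<open>aP\<close> under intersection. Two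
  elements \<open>[p,q]\<close> and \<open>[c,d]\<close> therefore have the same germ at a tight filter iff their partial maps
  agree at a point \<open>q m = d n\<close> whose ideal belongs to the filter (lemma \<open>germ_eq_iff\<close>). The locus where
  two such bisections meet is thus always a union of compact open sets \<open>D [r m, r m]\<close>, with \<open>m\<close> ranging
  over the solutions of one equation \<open>a m = b m\<close> in \<open>P\<close>. It is open in any case, and the groupoid is
  Hausdorff iff it is always closed.

  Condition (H) says that finitely many of these sets suffice. If the locus is closed, then it is
  compact, as the tight spectrum of a semigroup with identity is compact (\<open>compact_tight_space\<close>); a
  finite subcover gives \<open>F\<close>, because every nonzero idempotent lies in an ultrafilter
  (\<open>condition_H_if_Hausdorff\<close>). Conversely, let \<open>F\<close> be as in (H). The solutions are stable under
  right multiplication, so every subideal of a \<open>bP\<close> with \<open>b\<close> a solution meets some \<open>fP\<close>. An ultrafilter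
  containing \<open>[b,b]\<close> must then contain some \<open>[f,f]\<close>, and by density so must a tight filter
  (\<open>D_set_finite_cover\<close>). The locus is a finite union of clopen sets, hence closed
  (\<open>closedin_agreement\<close>, \<open>Hausdorff_if_condition_H\<close>).
\<close>

lemma Union_eq_of_unique:
  assumes "\<And>Z. Z \<in> \<Z> \<Longrightarrow> Z = X" "X \<in> \<Z>"
  shows "\<Union>\<Z> = X"
  using assms by blast

lemma closedin_Collect_conj:
  assumes "closedin X {x \<in> topspace X. A x}" "closedin X {x \<in> topspace X. B x}"
  shows "closedin X {x \<in> topspace X. A x \<and> B x}"
proof -
  have "{x \<in> topspace X. A x \<and> B x} = {x \<in> topspace X. A x} \<inter> {x \<in> topspace X. B x}"
    by blast
  then show ?thesis
    using assms closedin_Int by metis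
qed

lemma closedin_Collect_ball:
  assumes "\<And>i. i \<in> I \<Longrightarrow> closedin X {x \<in> topspace X. A i x}"
  shows "closedin X {x \<in> topspace X. \<forall>i\<in>I. A i x}"
proof (cases "I = {}")
  case False
  then have "{x \<in> topspace X. \<forall>i\<in>I. A i x} = (\<Inter>i\<in>I. {x \<in> topspace X. A i x})"
    by blast
  then show ?thesis
    using False assms by (simp add: closedin_INT)
qed simp

context right_LCM_monoid
begin

section \<open>Principal right ideals\<close>

abbreviation rid :: "'a \<Rightarrow> 'a set" where
  "rid a \<equiv> principal_right_ideal P a"

abbreviation frac :: "'a \<Rightarrow> 'a \<Rightarrow> ('a \<times> 'a) set" where
  "frac p q \<equiv> pair_class P p q"

abbreviation proj :: "'a \<Rightarrow> ('a \<times> 'a) set" where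
  "proj a \<equiv> pair_class P a a"

abbreviation S :: "('a \<times> 'a) set semigroup0" where
  "S \<equiv> lcm_inverse_semigroup P"

lemma mem_rid: "x \<in> rid a \<longleftrightarrow> (\<exists>y\<in>carrier P. x = a \<otimes> y)"
  by (auto simp: principal_right_ideal_def)

lemma self_mem_rid: "a \<in> carrier P \<Longrightarrow> a \<in> rid a"
  unfolding mem_rid by (metis one_closed r_one)

lemma mult_mem_rid: "y \<in> carrier P \<Longrightarrow> a \<otimes> y \<in> rid a"
  unfolding mem_rid by blast

lemma rid_closed: "a \<in> carrier P \<Longrightarrow> rid a \<subseteq> carrier P"
  by (auto simp: mem_rid)

lemma rid_subset_iff:
  assumes "a \<in> carrier P" "b \<in> carrier P"
  shows "rid a \<subseteq> rid b \<longleftrightarrow> a \<in> rid b"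
proof
  assume "a \<in> rid b"
  then obtain y where "y \<in> carrier P" "a = b \<otimes> y"
    by (auto simp: mem_rid)
  then show "rid a \<subseteq> rid b"
    using assms by (auto simp: mem_rid m_assoc intro!: bexI[of _ "y \<otimes> _"])
qed (use assms self_mem_rid in blast)

text \<open>Cancel \<open>x\<close> on the left in \<open>x (y x) = x\<close>.\<close>

lemma right_inverse_Units:
  assumes "x \<in> carrier P" "y \<in> carrier P" "x \<otimes> y = \<one>"
  shows "x \<in> Units P" "y \<in> Units P"
proof -
  have "x \<otimes> (y \<otimes> x) = x \<otimes> \<one>"
    using assms by (metis m_assoc l_one r_one)
  then have "y \<otimes> x = \<one>"
    using assms left_cancel by (metis m_closed one_closed)
  then show "x \<in> Units P" "y \<in> Units P"
    using assms by (auto simp: Units_def)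
qed

lemma mult_Unit_eq_iff:
  assumes "a \<in> carrier P" "u \<in> Units P"
  shows "a \<otimes> u = p \<longleftrightarrow> p \<in> carrier P \<and> a = p \<otimes> inv u"
  using assms by (auto simp: m_assoc Units_closed)

lemma rid_eq_unit:
  assumes "a \<in> carrier P" "b \<in> carrier P" "rid a = rid b"
  obtains u where "u \<in> Units P" "b = a \<otimes> u"
proof -
  obtain x y where xy: "x \<in> carrier P" "y \<in> carrier P" "a = b \<otimes> x" "b = a \<otimes> y"
    using assms self_mem_rid by (metis mem_rid)
  then have "a \<otimes> (y \<otimes> x) = a \<otimes> \<one>"
    using assms by (metis m_assoc r_one)
  then have "y \<otimes> x = \<one>"
    using xy assms left_cancel by (metis m_closed one_closed)
  then show ?thesis
    using that xy right_inverse_Units by blast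
qed

lemma lcm_exists:
  assumes "a \<in> carrier P" "b \<in> carrier P" "rid a \<inter> rid b \<noteq> {}"
  obtains r a' b' where "r \<in> carrier P" "a' \<in> carrier P" "b' \<in> carrier P"
    "rid a \<inter> rid b = rid r" "a \<otimes> a' = r" "b \<otimes> b' = r"
proof -
  obtain r where r: "r \<in> carrier P" "rid a \<inter> rid b = rid r"
    using right_LCM assms by blast
  then have "r \<in> rid a" "r \<in> rid b"
    using self_mem_rid by blast+
  with r show ?thesis
    using that by (auto simp: mem_rid)
qed

lemma rid_translate_meet:
  assumes "r \<in> carrier P" "a \<in> carrier P" "b \<in> carrier P" "rid a \<inter> rid b \<noteq> {}"
  shows "rid (r \<otimes> a) \<inter> rid (r \<otimes> b) \<noteq> {}"
proof -
  obtain x y where xy: "x \<in> carrier P" "y \<in> carrier P" "a \<otimes> x = b \<otimes> y"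
    using assms(4) by (auto simp: mem_rid)
  then have "(r \<otimes> a) \<otimes> x = (r \<otimes> b) \<otimes> y"
    using assms(1-3) by (metis m_assoc)
  then show ?thesis
    using xy mult_mem_rid by (metis disjoint_iff)
qed

section \<open>The inverse semigroup of quotients\<close>

lemma equiv_pair_rel: "equiv (carrier P \<times> carrier P) (pair_rel P)"
proof (rule equivI)
  show "pair_rel P \<subseteq> (carrier P \<times> carrier P) \<times> (carrier P \<times> carrier P)"
    by (auto simp: pair_rel_def)
  show "refl_on (carrier P \<times> carrier P) (pair_rel P)"
    by (auto simp: refl_on_def pair_rel_def intro!: bexI[of _ \<one>])
  show "sym (pair_rel P)"
  proof (rule symI)
    fix v w assume "(v, w) \<in> pair_rel P"
    then obtain p q a b u where *: "v = (p, q)" "w = (a, b)" "p \<in> carrier P" "q \<in> carrier P"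
      "a \<in> carrier P" "b \<in> carrier P" "u \<in> Units P" "a \<otimes> u = p" "b \<otimes> u = q"
      by (auto simp: pair_rel_def)
    then have "p \<otimes> inv u = a" "q \<otimes> inv u = b"
      by (metis mult_Unit_eq_iff)+
    with * show "(w, v) \<in> pair_rel P"
      by (auto simp: pair_rel_def)
  qed
  show "trans (pair_rel P)"
  proof (rule transI)
    fix v w z assume "(v, w) \<in> pair_rel P" "(w, z) \<in> pair_rel P"
    then obtain p q a b c d u t where *: "v = (p, q)" "w = (a, b)" "z = (c, d)"
      "p \<in> carrier P" "q \<in> carrier P" "a \<in> carrier P" "b \<in> carrier P" "c \<in> carrier P" "d \<in> carrier P"
      "u \<in> Units P" "a \<otimes> u = p" "b \<otimes> u = q" "t \<in> Units P" "c \<otimes> t = a" "d \<otimes> t = b"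
      by (auto simp: pair_rel_def)
    then have "c \<otimes> (t \<otimes> u) = p" "d \<otimes> (t \<otimes> u) = q" "t \<otimes> u \<in> Units P"
      by (auto simp: m_assoc Units_closed)
    with * show "(v, z) \<in> pair_rel P"
      by (auto simp: pair_rel_def)
  qed
qed

lemma mem_frac:
  "(a, b) \<in> frac p q \<longleftrightarrow> p \<in> carrier P \<and> q \<in> carrier P \<and> a \<in> carrier P \<and> b \<in> carrier P \<and>
     (\<exists>u\<in>Units P. a \<otimes> u = p \<and> b \<otimes> u = q)"
  by (simp add: pair_class_def pair_rel_def Image_singleton_iff)

lemma frac_self: "\<lbrakk>p \<in> carrier P; q \<in> carrier P\<rbrakk> \<Longrightarrow> (p, q) \<in> frac p q"
  unfolding mem_frac by (intro conjI bexI[of _ \<one>]) simp_all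

lemma frac_nonempty: "\<lbrakk>p \<in> carrier P; q \<in> carrier P\<rbrakk> \<Longrightarrow> frac p q \<noteq> {}"
  using frac_self by blast

lemma frac_eq_iff:
  assumes "p \<in> carrier P" "q \<in> carrier P" "c \<in> carrier P" "d \<in> carrier P"
  shows "frac p q = frac c d \<longleftrightarrow> (\<exists>u\<in>Units P. c \<otimes> u = p \<and> d \<otimes> u = q)"
proof -
  have "frac p q = frac c d \<longleftrightarrow> ((p, q), (c, d)) \<in> pair_rel P"
    unfolding pair_class_def using assms by (intro eq_equiv_class_iff[OF equiv_pair_rel]) auto
  then show ?thesis
    using assms by (simp add: pair_rel_def)
qed

lemma proj_eq_iff:
  assumes "a \<in> carrier P" "b \<in> carrier P"
  shows "proj a = proj b \<longleftrightarrow> rid a = rid b"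
proof
  assume "proj a = proj b"
  then obtain u where u: "u \<in> Units P" "b \<otimes> u = a"
    using assms by (auto simp: frac_eq_iff)
  then have "b = a \<otimes> inv u"
    using assms mult_Unit_eq_iff by metis
  with u assms have "a \<in> rid b" "b \<in> rid a"
    using mult_mem_rid[of u b] mult_mem_rid[of "inv u" a] by auto
  then show "rid a = rid b"
    using assms by (simp add: rid_subset_iff[symmetric])
next
  assume "rid a = rid b"
  then obtain u where "u \<in> Units P" "a = b \<otimes> u"
    using rid_eq_unit assms by metis
  then show "proj a = proj b"
    unfolding frac_eq_iff[OF assms(1,1) assms(2,2)] by blast
qed

lemma carrier_S: "X \<in> carrier S \<longleftrightarrow> X = {} \<or> (\<exists>p\<in>carrier P. \<exists>q\<in>carrier P. X = frac p q)"
  unfolding lcm_inverse_semigroup_def by simp blast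

lemma frac_closed: "\<lbrakk>p \<in> carrier P; q \<in> carrier P\<rbrakk> \<Longrightarrow> frac p q \<in> carrier S"
  unfolding carrier_S by blast

lemma prod_S:
  "X \<cdot>\<^bsub>S\<^esub> Y = \<Union> {frac (a \<otimes> b') (d \<otimes> c') | a b c d b' c'.
        (a, b) \<in> X \<and> (c, d) \<in> Y \<and> b' \<in> carrier P \<and> c' \<in> carrier P \<and>
        (\<exists>r\<in>carrier P. rid c \<inter> rid b = rid r \<and> c \<otimes> c' = r \<and> b \<otimes> b' = r)}"
  by (simp add: lcm_inverse_semigroup_def)

lemma prod_zero [simp]: "{} \<cdot>\<^bsub>S\<^esub> X = {}" "X \<cdot>\<^bsub>S\<^esub> {} = {}"
  by (simp_all add: prod_S)

text \<open>Changing a representative multiplies by units on the right; left cancellation lets these units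
  be carried through the equations \<open>c c' = b b' = r\<close>, so they only change the representative of
  the product.\<close>

lemma frac_prod:
  assumes [simp]: "a \<in> carrier P" "b \<in> carrier P" "c \<in> carrier P" "d \<in> carrier P"
      "b' \<in> carrier P" "c' \<in> carrier P"
    and r: "rid b \<inter> rid c = rid r" "b \<otimes> b' = r" "c \<otimes> c' = r"
  shows "frac a b \<cdot>\<^bsub>S\<^esub> frac c d = frac (a \<otimes> b') (d \<otimes> c')"
proof -
  have [simp]: "r \<in> carrier P"
    using r by auto
  have same: "frac (a1 \<otimes> b1') (d1 \<otimes> c1') = frac (a \<otimes> b') (d \<otimes> c')"
    if 1: "(a1, b1) \<in> frac a b" "(c1, d1) \<in> frac c d" and [simp]: "b1' \<in> carrier P" "c1' \<in> carrier P"
      and [simp]: "r1 \<in> carrier P" and r1: "rid c1 \<inter> rid b1 = rid r1" "c1 \<otimes> c1' = r1" "b1 \<otimes> b1' = r1"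
    for a1 b1 c1 d1 b1' c1' r1
  proof -
    have [simp]: "a1 \<in> carrier P" "b1 \<in> carrier P" "c1 \<in> carrier P" "d1 \<in> carrier P"
      using 1 by (auto simp: mem_frac)
    obtain u v where u: "u \<in> Units P" "a1 \<otimes> u = a" "b1 \<otimes> u = b"
      and v: "v \<in> Units P" "c1 \<otimes> v = c" "d1 \<otimes> v = d"
      using 1 by (auto simp: mem_frac)
    have [simp]: "u \<in> carrier P" "v \<in> carrier P"
      using u v by auto
    have "proj b1 = proj b" "proj c1 = proj c"
      using u v frac_eq_iff[of b b b1 b1] frac_eq_iff[of c c c1 c1] by auto
    then have "rid b1 = rid b" "rid c1 = rid c"
      by (simp_all add: proj_eq_iff)
    then have "rid r1 = rid r"
      using r r1 by auto
    then obtain w where w: "w \<in> Units P" "r = r1 \<otimes> w"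
      using rid_eq_unit[of r1 r] by auto
    have [simp]: "w \<in> carrier P"
      using w by auto
    have "b1 \<otimes> (u \<otimes> b') = b1 \<otimes> (b1' \<otimes> w)" "c1 \<otimes> (v \<otimes> c') = c1 \<otimes> (c1' \<otimes> w)"
      using u v w r r1 by (simp_all add: m_assoc[symmetric])
    then have "u \<otimes> b' = b1' \<otimes> w" "v \<otimes> c' = c1' \<otimes> w"
      by (auto dest: left_cancel[rotated 3])
    then have "a \<otimes> b' = (a1 \<otimes> b1') \<otimes> w" "d \<otimes> c' = (d1 \<otimes> c1') \<otimes> w"
      unfolding u(2)[symmetric] v(3)[symmetric] by (simp_all add: m_assoc)
    then show ?thesis
      using w frac_eq_iff[of "a \<otimes> b'" "d \<otimes> c'" "a1 \<otimes> b1'" "d1 \<otimes> c1'"] by auto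
  qed
  have here: "(a, b) \<in> frac a b" "(c, d) \<in> frac c d" "rid c \<inter> rid b = rid r"
    using r by (simp_all add: frac_self Int_commute)
  show ?thesis
    unfolding prod_S
  proof (rule Union_eq_of_unique)
    fix Z assume "Z \<in> {frac (a1 \<otimes> b1') (d1 \<otimes> c1') | a1 b1 c1 d1 b1' c1'.
        (a1, b1) \<in> frac a b \<and> (c1, d1) \<in> frac c d \<and> b1' \<in> carrier P \<and> c1' \<in> carrier P \<and>
        (\<exists>r1\<in>carrier P. rid c1 \<inter> rid b1 = rid r1 \<and> c1 \<otimes> c1' = r1 \<and> b1 \<otimes> b1' = r1)}"
    then show "Z = frac (a \<otimes> b') (d \<otimes> c')"
      by (elim CollectE exE conjE bexE) (simp only: same)
  next
    show "frac (a \<otimes> b') (d \<otimes> c') \<in> {frac (a1 \<otimes> b1') (d1 \<otimes> c1') | a1 b1 c1 d1 b1' c1'.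
        (a1, b1) \<in> frac a b \<and> (c1, d1) \<in> frac c d \<and> b1' \<in> carrier P \<and> c1' \<in> carrier P \<and>
        (\<exists>r1\<in>carrier P. rid c1 \<inter> rid b1 = rid r1 \<and> c1 \<otimes> c1' = r1 \<and> b1 \<otimes> b1' = r1)}"
      by (rule CollectI, rule exI[of _ a], rule exI[of _ b], rule exI[of _ c], rule exI[of _ d],
          rule exI[of _ b'], rule exI[of _ c'], intro conjI bexI[of _ r] refl here r assms \<open>r \<in> carrier P\<close>)
  qed
qed

lemma frac_rid:
  assumes "(a1, b1) \<in> frac a b"
  shows "a1 \<in> carrier P" "b1 \<in> carrier P" "rid a1 = rid a" "rid b1 = rid b"
proof -
  obtain u where u: "a \<in> carrier P" "b \<in> carrier P" "a1 \<in> carrier P" "b1 \<in> carrier P"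
    "u \<in> Units P" "a1 \<otimes> u = a" "b1 \<otimes> u = b"
    using assms unfolding mem_frac by (elim conjE bexE)
  then have "proj a = proj a1" "proj b = proj b1"
    unfolding frac_eq_iff[OF u(1,1,3,3)] frac_eq_iff[OF u(2,2,4,4)] by auto
  with u show "a1 \<in> carrier P" "b1 \<in> carrier P" "rid a1 = rid a" "rid b1 = rid b"
    by (simp_all add: proj_eq_iff)
qed

lemma frac_prod_disjoint:
  assumes "rid b \<inter> rid c = {}"
  shows "frac a b \<cdot>\<^bsub>S\<^esub> frac c d = {}"
proof -
  have False if "(a1, b1) \<in> frac a b" "(c1, d1) \<in> frac c d" "r \<in> carrier P" "rid c1 \<inter> rid b1 = rid r"
    for a1 b1 c1 d1 r
  proof -
    have "rid b1 = rid b" "rid c1 = rid c"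
      using frac_rid[OF that(1)] frac_rid[OF that(2)] by simp_all
    then show False
      using assms that self_mem_rid by blast
  qed
  then have "{frac (a1 \<otimes> b1') (d1 \<otimes> c1') | a1 b1 c1 d1 b1' c1'.
        (a1, b1) \<in> frac a b \<and> (c1, d1) \<in> frac c d \<and> b1' \<in> carrier P \<and> c1' \<in> carrier P \<and>
        (\<exists>r1\<in>carrier P. rid c1 \<inter> rid b1 = rid r1 \<and> c1 \<otimes> c1' = r1 \<and> b1 \<otimes> b1' = r1)} = {}"
    by (intro equals0I) (elim CollectE exE conjE bexE)
  then show ?thesis
    unfolding prod_S by (simp only: Union_empty)
qed

lemma proj_prod:
  assumes "a \<in> carrier P" "b \<in> carrier P" "r \<in> carrier P" "rid a \<inter> rid b = rid r"
  shows "proj a \<cdot>\<^bsub>S\<^esub> proj b = proj r"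
proof -
  have "r \<in> rid a" "r \<in> rid b"
    using assms self_mem_rid by blast+
  then obtain a' b' where "a' \<in> carrier P" "b' \<in> carrier P" "a \<otimes> a' = r" "b \<otimes> b' = r"
    by (auto simp: mem_rid)
  then show ?thesis
    using assms frac_prod[of a a b b a' b' r] by simp
qed

text \<open>Multiplying \<open>[p,q]\<close> by the idempotent of \<open>q m P\<close> restricts the partial map \<open>q x \<mapsto> p x\<close> to
  that ideal. This is how two elements of the semigroup are compared below an idempotent.\<close>

lemma frac_proj_prod:
  assumes "p \<in> carrier P" "q \<in> carrier P" "m \<in> carrier P"
  shows "frac p q \<cdot>\<^bsub>S\<^esub> proj (q \<otimes> m) = frac (p \<otimes> m) (q \<otimes> m)"
proof -
  have "rid q \<inter> rid (q \<otimes> m) = rid (q \<otimes> m)"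
    using assms rid_subset_iff mult_mem_rid by blast
  then show ?thesis
    using assms frac_prod[of p q "q \<otimes> m" "q \<otimes> m" m \<one> "q \<otimes> m"] by simp
qed

lemma idems_S: "e \<in> idems S \<longleftrightarrow> e = {} \<or> (\<exists>a\<in>carrier P. e = proj a)"
proof
  assume e: "e \<in> idems S"
  show "e = {} \<or> (\<exists>a\<in>carrier P. e = proj a)"
  proof (rule disjCI)
    assume none: "\<not> (\<exists>a\<in>carrier P. e = proj a)"
    show "e = {}"
    proof (rule ccontr)
      assume "e \<noteq> {}"
      then obtain a b where ab: "a \<in> carrier P" "b \<in> carrier P" "e = frac a b"
        and idem: "e \<cdot>\<^bsub>S\<^esub> e = e"
        using e by (auto simp: idems_def carrier_S)
      have "rid b \<inter> rid a \<noteq> {}"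
        using frac_prod_disjoint[of b a a b] frac_nonempty[of a b] ab idem by auto
      then obtain r b' a' where r: "r \<in> carrier P" "b' \<in> carrier P" "a' \<in> carrier P"
        "rid b \<inter> rid a = rid r" "b \<otimes> b' = r" "a \<otimes> a' = r"
        using lcm_exists ab by metis
      then have "frac a b = frac (a \<otimes> b') (b \<otimes> a')"
        using frac_prod[of a b a b b' a' r] ab idem by simp
      then obtain u where u: "u \<in> Units P" "a \<otimes> b' \<otimes> u = a" "b \<otimes> a' \<otimes> u = b"
        using frac_eq_iff[of a b "a \<otimes> b'" "b \<otimes> a'"] ab r by auto
      then have "a \<otimes> (b' \<otimes> u) = a \<otimes> \<one>" "b \<otimes> (a' \<otimes> u) = b \<otimes> \<one>"
        using ab r by (auto simp: m_assoc)
      then have "b' \<otimes> u = \<one>" "a' \<otimes> u = \<one>"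
        using u ab r left_cancel Units_closed by (meson m_closed one_closed)+
      then have "b = r \<otimes> u" "a = r \<otimes> u"
        using ab r u by (metis m_assoc r_one Units_closed)+
      then show False
        using none ab by auto
    qed
  qed
next
  assume "e = {} \<or> (\<exists>a\<in>carrier P. e = proj a)"
  then consider "e = {}" | a where "a \<in> carrier P" "e = proj a"
    by blast
  then show "e \<in> idems S"
  proof cases
    case 1
    then show ?thesis
      by (simp add: idems_def carrier_S)
  next
    case 2
    then have "e \<in> carrier S"
      unfolding carrier_S by blast
    moreover have "e \<cdot>\<^bsub>S\<^esub> e = e"
      using 2 proj_prod[of a a a] by simp
    ultimately show ?thesis
      by (simp add: idems_def)
  qed
qed

lemma zero_idem: "{} \<in> idems S" and proj_idem: "a \<in> carrier P \<Longrightarrow> proj a \<in> idems S"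
  using idems_S by metis+

lemma idem_prod_closed:
  assumes "e \<in> idems S" "f \<in> idems S"
  shows "e \<cdot>\<^bsub>S\<^esub> f \<in> idems S"
proof (cases "e = {} \<or> f = {}")
  case True
  then show ?thesis
    using zero_idem by auto
next
  case False
  then obtain a b where ab: "a \<in> carrier P" "b \<in> carrier P" "e = proj a" "f = proj b"
    using assms by (metis idems_S)
  show ?thesis
  proof (cases "rid a \<inter> rid b = {}")
    case True
    then show ?thesis
      using ab frac_prod_disjoint zero_idem by simp
  next
    case False
    then obtain r where "r \<in> carrier P" "rid a \<inter> rid b = rid r"
      using lcm_exists[OF ab(1,2)] by metis
    then show ?thesis
      using ab proj_prod[of a b r] proj_idem[of r] by simp
  qed
qed

text \<open>Both products in the equation are nonzero. With \<open>b b' = c c'\<close> a least common multiple, comparing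
  numerators gives \<open>a b' z = a\<close> for some \<open>z\<close>. So \<open>b' z = 1\<close> and \<open>b = (b b') z\<close> is a multiple of \<open>c\<close>.\<close>

lemma inverse_ideal_subset:
  assumes [simp]: "a \<in> carrier P" "b \<in> carrier P" "c \<in> carrier P" "d \<in> carrier P"
    and eq: "frac a b \<cdot>\<^bsub>S\<^esub> frac c d \<cdot>\<^bsub>S\<^esub> frac a b = frac a b"
  shows "b \<in> rid c"
proof -
  have "rid b \<inter> rid c \<noteq> {}"
    using frac_prod_disjoint[of b c a d] frac_nonempty[of a b] eq by auto
  then obtain r b' c' where r: "r \<in> carrier P" "b' \<in> carrier P" "c' \<in> carrier P"
    "rid b \<inter> rid c = rid r" "b \<otimes> b' = r" "c \<otimes> c' = r"
    using lcm_exists[of b c] by auto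
  then have 1: "frac a b \<cdot>\<^bsub>S\<^esub> frac c d = frac (a \<otimes> b') (d \<otimes> c')"
    by (intro frac_prod) auto
  have "rid (d \<otimes> c') \<inter> rid a \<noteq> {}"
    using 1 r frac_prod_disjoint[of "d \<otimes> c'" a "a \<otimes> b'" b] frac_nonempty[of a b] eq by auto
  then obtain v x y where v: "v \<in> carrier P" "x \<in> carrier P" "y \<in> carrier P"
    "rid (d \<otimes> c') \<inter> rid a = rid v" "d \<otimes> c' \<otimes> x = v" "a \<otimes> y = v"
    using lcm_exists[of "d \<otimes> c'" a] r by auto
  then have "frac a b = frac (a \<otimes> b' \<otimes> x) (b \<otimes> y)"
    using frac_prod[of "a \<otimes> b'" "d \<otimes> c'" a b x y v] r 1 eq by simp
  then obtain u where u: "u \<in> Units P" "a \<otimes> b' \<otimes> x \<otimes> u = a"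
    using frac_eq_iff[of a b "a \<otimes> b' \<otimes> x" "b \<otimes> y"] r v by auto
  have [simp]: "u \<in> carrier P"
    using u by auto
  have "a \<otimes> (b' \<otimes> (x \<otimes> u)) = a \<otimes> \<one>"
    using u r v by (simp add: m_assoc)
  then have "b' \<otimes> (x \<otimes> u) = \<one>"
    using r v left_cancel[of a "b' \<otimes> (x \<otimes> u)" \<one>] by auto
  then have "b = r \<otimes> (x \<otimes> u)"
    using r(2,5) v(2) by (metis assms(2) \<open>u \<in> carrier P\<close> m_assoc m_closed r_one)
  then have "b \<in> rid r"
    using v by (simp add: mult_mem_rid)
  then show ?thesis
    using r by blast
qed

text \<open>Let \<open>t = [c,d]\<close> be another inverse. By the previous lemma and its mirror image, \<open>b = c k\<close> and
  \<open>d = a l\<close>. The equation \<open>[a,b] t [a,b] = [a,b]\<close> then becomes \<open>l k = 1\<close>, so \<open>k\<close> and \<open>l\<close> are units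
  and \<open>t = [b,a]\<close>.\<close>

lemma star_frac:
  assumes [simp]: "a \<in> carrier P" "b \<in> carrier P"
  shows "star S (frac a b) = frac b a"
  unfolding star_def
proof (rule the_equality)
  have "frac a b \<cdot>\<^bsub>S\<^esub> frac b a = proj a" "frac b a \<cdot>\<^bsub>S\<^esub> frac a b = proj b"
    using frac_prod[of a b b a \<one> \<one> b] frac_prod[of b a a b \<one> \<one> a] by auto
  moreover have "proj a \<cdot>\<^bsub>S\<^esub> frac a b = frac a b" "proj b \<cdot>\<^bsub>S\<^esub> frac b a = frac b a"
    using frac_prod[of a a a b \<one> \<one> a] frac_prod[of b b b a \<one> \<one> b] by auto
  ultimately show "frac b a \<in> carrier S \<and> frac a b \<cdot>\<^bsub>S\<^esub> frac b a \<cdot>\<^bsub>S\<^esub> frac a b = frac a b \<and>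
      frac b a \<cdot>\<^bsub>S\<^esub> frac a b \<cdot>\<^bsub>S\<^esub> frac b a = frac b a"
    by (simp add: frac_closed)
next
  fix t
  assume t: "t \<in> carrier S \<and> frac a b \<cdot>\<^bsub>S\<^esub> t \<cdot>\<^bsub>S\<^esub> frac a b = frac a b \<and> t \<cdot>\<^bsub>S\<^esub> frac a b \<cdot>\<^bsub>S\<^esub> t = t"
  have "t \<noteq> {}"
    using t frac_nonempty[of a b] by auto
  then obtain c d where cd [simp]: "c \<in> carrier P" "d \<in> carrier P" and tcd: "t = frac c d"
    using t by (metis carrier_S)
  have "b \<in> rid c" "d \<in> rid a"
    using t tcd inverse_ideal_subset[of a b c d] inverse_ideal_subset[of c d a b] by auto
  then obtain k l where [simp]: "k \<in> carrier P" "l \<in> carrier P" and kl: "b = c \<otimes> k" "d = a \<otimes> l"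
    by (auto simp: mem_rid)
  have "rid b \<inter> rid c = rid b"
    using \<open>b \<in> rid c\<close> rid_subset_iff[of b c] by (simp add: Int_absorb2)
  then have "frac a b \<cdot>\<^bsub>S\<^esub> t = frac a (d \<otimes> k)"
    unfolding tcd using frac_prod[of a b c d \<one> k b] kl(1)[symmetric] by simp
  moreover have dk: "d \<otimes> k = a \<otimes> (l \<otimes> k)"
    unfolding kl(2) by (simp add: m_assoc)
  then have "rid (d \<otimes> k) \<inter> rid a = rid (d \<otimes> k)"
    using rid_subset_iff[of "d \<otimes> k" a] mult_mem_rid[of "l \<otimes> k" a] by (simp add: Int_absorb2)
  then have "frac a (d \<otimes> k) \<cdot>\<^bsub>S\<^esub> frac a b = frac a (b \<otimes> (l \<otimes> k))"
    using frac_prod[of a "d \<otimes> k" a b \<one> "l \<otimes> k" "d \<otimes> k"] dk[symmetric] by simp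
  ultimately have "frac a b = frac a (b \<otimes> (l \<otimes> k))"
    using t by simp
  then obtain u where u: "u \<in> Units P" "a \<otimes> u = a" "b \<otimes> (l \<otimes> k) \<otimes> u = b"
    using frac_eq_iff[of a b a "b \<otimes> (l \<otimes> k)"] by simp blast
  then have "u = \<one>"
    using u left_cancel[of a u \<one>] by (simp add: Units_closed)
  then have "l \<otimes> k = \<one>"
    using u left_cancel[of b "l \<otimes> k" \<one>] by simp
  then have "k \<in> Units P" "l \<in> Units P"
    using right_inverse_Units[of l k] by auto
  moreover have "a = d \<otimes> k"
    using dk \<open>l \<otimes> k = \<one>\<close> by simp
  ultimately show "t = frac b a"
    unfolding tcd using kl(1) frac_eq_iff[of b a c d] by (metis assms cd)
qed

lemma star_prod_frac:
  assumes "a \<in> carrier P" "b \<in> carrier P"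
  shows "star S (frac a b) \<cdot>\<^bsub>S\<^esub> frac a b = proj b"
  using assms frac_prod[of b a a b \<one> \<one> a] by (simp add: star_frac)

lemma nat_le_proj:
  assumes "a \<in> carrier P" "b \<in> carrier P"
  shows "nat_le S (proj a) (proj b) \<longleftrightarrow> rid a \<subseteq> rid b"
proof (cases "rid b \<inter> rid a = {}")
  case True
  then have "\<not> rid a \<subseteq> rid b"
    using assms self_mem_rid by blast
  then show ?thesis
    using True assms frac_nonempty[of a a] by (simp add: nat_le_def star_frac frac_prod_disjoint)
next
  case False
  then obtain r where r: "r \<in> carrier P" "rid b \<inter> rid a = rid r"
    using lcm_exists assms by metis
  then have "rid r \<inter> rid a = rid r"
    by auto
  then have "proj b \<cdot>\<^bsub>S\<^esub> proj a \<cdot>\<^bsub>S\<^esub> proj a = proj r"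
    using assms r by (simp add: proj_prod)
  then have "nat_le S (proj a) (proj b) \<longleftrightarrow> rid a = rid r"
    using assms r by (simp add: nat_le_def star_frac proj_eq_iff)
  then show ?thesis
    using r by auto
qed

lemma nat_le_zero: "nat_le S {} e"
  by (simp add: nat_le_def)

lemma nat_le_zero_right: "nat_le S e {} \<Longrightarrow> e = {}"
  by (simp add: nat_le_def)

section \<open>Filters and ultrafilters of principal right ideals\<close>

text \<open>Zero is the least idempotent and the class of \<open>(1,1)\<close> the greatest, so properness means that zero is
  absent and nonemptiness that the identity is present. In this form every condition mentions only
  finitely many idempotents, hence is clopen in the product space; compactness of the filter space
  rests on this.\<close>

lemma filters_iff:
  "\<xi> \<in> filters S \<longleftrightarrow> \<xi> \<subseteq> idems S \<and> {} \<notin> \<xi> \<and> proj \<one> \<in> \<xi> \<and>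
     (\<forall>e\<in>idems S. \<forall>f\<in>idems S. e \<in> \<xi> \<longrightarrow> f \<in> \<xi> \<longrightarrow> e \<cdot>\<^bsub>S\<^esub> f \<in> \<xi>) \<and>
     (\<forall>e\<in>idems S. \<forall>f\<in>idems S. nat_le S e f \<longrightarrow> e \<in> \<xi> \<longrightarrow> f \<in> \<xi>)"
proof
  assume \<xi>: "\<xi> \<in> filters S"
  then have sub: "\<xi> \<subseteq> idems S" and "\<xi> \<noteq> idems S" "\<xi> \<noteq> {}"
    and mult: "\<forall>e\<in>\<xi>. \<forall>f\<in>\<xi>. e \<cdot>\<^bsub>S\<^esub> f \<in> \<xi>" and up: "\<forall>e\<in>\<xi>. \<forall>f\<in>idems S. nat_le S e f \<longrightarrow> f \<in> \<xi>"
    unfolding filters_def by (simp_all add: psubset_eq)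
  have zero: "{} \<notin> \<xi>"
    using sub up nat_le_zero \<open>\<xi> \<noteq> idems S\<close> by (meson subset_antisym subset_iff)
  obtain e where e: "e \<in> \<xi>"
    using \<open>\<xi> \<noteq> {}\<close> by (meson ex_in_conv)
  then obtain a where a: "a \<in> carrier P" "e = proj a"
    using zero sub by (metis idems_S subset_iff)
  have "rid a \<subseteq> rid \<one>"
    using a rid_subset_iff[of a \<one>] mult_mem_rid[of a \<one>] by simp
  then have "nat_le S e (proj \<one>)"
    using a nat_le_proj[of a \<one>] by simp
  then have "proj \<one> \<in> \<xi>"
    using e up proj_idem[OF one_closed] by blast
  with sub zero mult up show "\<xi> \<subseteq> idems S \<and> {} \<notin> \<xi> \<and> proj \<one> \<in> \<xi> \<and>
     (\<forall>e\<in>idems S. \<forall>f\<in>idems S. e \<in> \<xi> \<longrightarrow> f \<in> \<xi> \<longrightarrow> e \<cdot>\<^bsub>S\<^esub> f \<in> \<xi>) \<and>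
     (\<forall>e\<in>idems S. \<forall>f\<in>idems S. nat_le S e f \<longrightarrow> e \<in> \<xi> \<longrightarrow> f \<in> \<xi>)"
    by simp
next
  assume *: "\<xi> \<subseteq> idems S \<and> {} \<notin> \<xi> \<and> proj \<one> \<in> \<xi> \<and>
     (\<forall>e\<in>idems S. \<forall>f\<in>idems S. e \<in> \<xi> \<longrightarrow> f \<in> \<xi> \<longrightarrow> e \<cdot>\<^bsub>S\<^esub> f \<in> \<xi>) \<and>
     (\<forall>e\<in>idems S. \<forall>f\<in>idems S. nat_le S e f \<longrightarrow> e \<in> \<xi> \<longrightarrow> f \<in> \<xi>)"
  then have "\<xi> \<noteq> {}" "\<xi> \<subset> idems S"
    using zero_idem by (metis empty_iff, metis psubset_eq)
  moreover have "\<forall>e\<in>\<xi>. \<forall>f\<in>\<xi>. e \<cdot>\<^bsub>S\<^esub> f \<in> \<xi>" "\<forall>e\<in>\<xi>. \<forall>f\<in>idems S. nat_le S e f \<longrightarrow> f \<in> \<xi>"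
    using * by (meson subset_iff)+
  ultimately show "\<xi> \<in> filters S"
    by (simp add: filters_def)
qed

lemma filter_elements:
  assumes "\<xi> \<in> filters S" "e \<in> \<xi>"
  obtains a where "a \<in> carrier P" "e = proj a"
  using assms unfolding filters_iff by (metis idems_S subset_iff)

lemma filter_meet:
  assumes "\<xi> \<in> filters S" "proj a \<in> \<xi>" "proj b \<in> \<xi>" "a \<in> carrier P" "b \<in> carrier P"
  obtains r where "r \<in> carrier P" "rid a \<inter> rid b = rid r" "proj r \<in> \<xi>"
proof -
  have in\<xi>: "proj a \<cdot>\<^bsub>S\<^esub> proj b \<in> \<xi>"
    using assms proj_idem unfolding filters_iff by meson
  have "rid a \<inter> rid b \<noteq> {}"
  proof
    assume "rid a \<inter> rid b = {}"
    then have "{} \<in> \<xi>"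
      using in\<xi> frac_prod_disjoint[of a b a b] by simp
    with assms(1) show False
      unfolding filters_iff by meson
  qed
  then obtain r where "r \<in> carrier P" "rid a \<inter> rid b = rid r"
    using lcm_exists[OF assms(4,5)] by metis
  with that in\<xi> assms show ?thesis
    by (simp add: proj_prod)
qed

text \<open>Every filter needed below is generated by a downward directed family of principal right ideals.\<close>

lemma generated_filter:
  assumes "B \<subseteq> carrier P" "B \<noteq> {}"
    and directed: "\<And>a b. \<lbrakk>a \<in> B; b \<in> B\<rbrakk> \<Longrightarrow> \<exists>c\<in>B. rid c \<subseteq> rid a \<inter> rid b"
  shows "proj ` {b \<in> carrier P. \<exists>c\<in>B. rid c \<subseteq> rid b} \<in> filters S"
proof -
  let ?A = "{b \<in> carrier P. \<exists>c\<in>B. rid c \<subseteq> rid b}"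
  have "rid \<one> = carrier P"
    by (auto simp: mem_rid)
  then have one: "proj \<one> \<in> proj ` ?A"
    using assms(1,2) rid_closed by blast
  have zero: "{} \<notin> proj ` ?A"
    using frac_nonempty by blast
  have mult: "e \<cdot>\<^bsub>S\<^esub> f \<in> proj ` ?A" if ef: "e \<in> proj ` ?A" "f \<in> proj ` ?A" for e f
  proof -
    obtain a b a' b' where ab: "a \<in> carrier P" "b \<in> carrier P" "e = proj a" "f = proj b"
      "a' \<in> B" "b' \<in> B" "rid a' \<subseteq> rid a" "rid b' \<subseteq> rid b"
      using ef by blast
    obtain c where c: "c \<in> B" "rid c \<subseteq> rid a' \<inter> rid b'"
      using directed[OF ab(5,6)] by blast
    then have "rid a \<inter> rid b \<noteq> {}"
      using ab self_mem_rid[of c] assms(1) by blast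
    then obtain r where r: "r \<in> carrier P" "rid a \<inter> rid b = rid r"
      using lcm_exists[OF ab(1,2)] by metis
    then have "r \<in> ?A"
      using c ab by blast
    then show ?thesis
      using ab r by (simp add: proj_prod)
  qed
  have up: "f \<in> proj ` ?A" if ef: "nat_le S e f" "e \<in> proj ` ?A" "f \<in> idems S" for e f
  proof -
    obtain a c where a: "a \<in> carrier P" "e = proj a" "c \<in> B" "rid c \<subseteq> rid a"
      using ef(2) by blast
    then have "f \<noteq> {}"
      using ef(1) nat_le_zero_right frac_nonempty by metis
    then obtain b where b: "b \<in> carrier P" "f = proj b"
      using ef(3) by (metis idems_S)
    then have "rid a \<subseteq> rid b"
      using a ef(1) nat_le_proj by metis
    then have "b \<in> ?A"
      using a b by blast
    then show ?thesis
      using b by simp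
  qed
  have "proj ` ?A \<subseteq> idems S"
    using proj_idem by blast
  then show ?thesis
    unfolding filters_iff using one zero mult up by simp
qed

lemma ultrafilter_exists:
  assumes "a \<in> carrier P"
  obtains \<xi> where "\<xi> \<in> ultrafilters S" "proj a \<in> \<xi>"
proof -
  let ?\<A> = "{\<eta> \<in> filters S. proj a \<in> \<eta>}"
  have "proj ` {b \<in> carrier P. \<exists>c\<in>{a}. rid c \<subseteq> rid b} \<in> ?\<A>"
    using generated_filter[of "{a}"] assms by simp
  then have "?\<A> \<noteq> {}"
    by (metis empty_iff)
  moreover have "\<Union>\<C> \<in> ?\<A>" if "\<C> \<noteq> {}" "subset.chain ?\<A> \<C>" for \<C>
  proof -
    have sub: "\<C> \<subseteq> ?\<A>" and chain: "\<And>X Y. X \<in> \<C> \<Longrightarrow> Y \<in> \<C> \<Longrightarrow> X \<subseteq> Y \<or> Y \<subseteq> X"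
      using that(2) by (auto simp: subset_chain_def)
    have filt: "X \<in> filters S" "proj a \<in> X" if "X \<in> \<C>" for X
      using sub that by auto
    obtain X where X: "X \<in> \<C>"
      using \<open>\<C> \<noteq> {}\<close> by blast
    have "e \<cdot>\<^bsub>S\<^esub> f \<in> \<Union>\<C>" if ef: "e \<in> idems S" "f \<in> idems S" "e \<in> \<Union>\<C>" "f \<in> \<Union>\<C>" for e f
    proof -
      obtain Y Z where YZ: "Y \<in> \<C>" "Z \<in> \<C>" "e \<in> Y" "f \<in> Z"
        using ef by blast
      then obtain W where "W \<in> \<C>" "e \<in> W" "f \<in> W"
        using chain[of Y Z] by blast
      then show ?thesis
        using filt(1)[of W] ef unfolding filters_iff by blast
    qed
    moreover have "f \<in> \<Union>\<C>" if "e \<in> idems S" "f \<in> idems S" "nat_le S e f" "e \<in> \<Union>\<C>" for e f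
      using that filt(1) unfolding filters_iff by blast
    moreover have "\<Union>\<C> \<subseteq> idems S" "{} \<notin> \<Union>\<C>" "proj \<one> \<in> \<Union>\<C>"
      using filt(1) X unfolding filters_iff by blast+
    ultimately have "\<Union>\<C> \<in> filters S"
      unfolding filters_iff by blast
    then show ?thesis
      using filt(2) X by blast
  qed
  ultimately obtain \<xi> where \<xi>: "\<xi> \<in> ?\<A>" "\<forall>\<eta>\<in>?\<A>. \<xi> \<subseteq> \<eta> \<longrightarrow> \<eta> = \<xi>"
    using subset_Zorn_nonempty[of ?\<A>] by blast
  then have "\<xi> \<in> ultrafilters S"
    unfolding ultrafilters_def by blast
  with \<xi> that show ?thesis
    by blast
qed

text \<open>If every \<open>cP\<close> with \<open>[c,c]\<close> in the filter met \<open>aP\<close>, the intersections would be nonempty principal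
  right ideals generating a filter that contains both the given one and \<open>[a,a]\<close>, against maximality.\<close>

lemma ultrafilter_excludes:
  assumes "\<xi> \<in> ultrafilters S" "a \<in> carrier P" "proj a \<notin> \<xi>"
  obtains c where "c \<in> carrier P" "proj c \<in> \<xi>" "rid c \<inter> rid a = {}"
proof -
  have filt: "\<xi> \<in> filters S"
    using assms(1) by (simp add: ultrafilters_def)
  let ?B = "{r \<in> carrier P. \<exists>c\<in>carrier P. proj c \<in> \<xi> \<and> rid c \<inter> rid a = rid r}"
  let ?\<eta> = "proj ` {b \<in> carrier P. \<exists>r\<in>?B. rid r \<subseteq> rid b}"
  show ?thesis
  proof (rule ccontr)
    assume "\<not> thesis"
    then have meets: "rid c \<inter> rid a \<noteq> {}" if "c \<in> carrier P" "proj c \<in> \<xi>" for c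
      using that \<open>\<And>c. \<lbrakk>c \<in> carrier P; proj c \<in> \<xi>; rid c \<inter> rid a = {}\<rbrakk> \<Longrightarrow> thesis\<close> by blast
    have lcm: "\<exists>r\<in>?B. rid r = rid c \<inter> rid a" if c: "c \<in> carrier P" "proj c \<in> \<xi>" for c
    proof -
      obtain r where "r \<in> carrier P" "rid c \<inter> rid a = rid r"
        using lcm_exists[OF c(1) assms(2) meets[OF c]] by metis
      then show ?thesis
        using c by blast
    qed
    have "\<exists>r\<in>?B. rid r \<subseteq> rid r1 \<inter> rid r2" if r: "r1 \<in> ?B" "r2 \<in> ?B" for r1 r2
    proof -
      obtain c1 c2 where c: "c1 \<in> carrier P" "proj c1 \<in> \<xi>" "rid c1 \<inter> rid a = rid r1"
        "c2 \<in> carrier P" "proj c2 \<in> \<xi>" "rid c2 \<inter> rid a = rid r2"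
        using r by blast
      obtain c' where c': "c' \<in> carrier P" "rid c1 \<inter> rid c2 = rid c'" "proj c' \<in> \<xi>"
        using filter_meet[OF filt c(2,5,1,4)] by metis
      obtain r where r: "r \<in> ?B" "rid r = rid c' \<inter> rid a"
        using lcm[OF c'(1,3)] by (rule bexE)
      have "rid r \<subseteq> rid r1 \<inter> rid r2"
        unfolding r(2) c'(2)[symmetric] c(3,6)[symmetric] by blast
      with r(1) show ?thesis
        by (rule bexI[rotated])
    qed
    moreover have one: "proj \<one> \<in> \<xi>"
      using filt unfolding filters_iff by meson
    then have "?B \<noteq> {}"
      using lcm[OF one_closed] by (metis empty_iff)
    ultimately have "?\<eta> \<in> filters S"
      by (intro generated_filter) simp_all
    moreover have "\<xi> \<subseteq> ?\<eta>"
    proof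
      fix e assume e: "e \<in> \<xi>"
      then obtain c where c: "c \<in> carrier P" "e = proj c"
        using filter_elements[OF filt] by metis
      have "proj c \<in> \<xi>"
        using e c(2) by simp
      then obtain r where r: "r \<in> ?B" "rid r = rid c \<inter> rid a"
        by (rule bexE[OF lcm[OF c(1)]])
      then have "rid r \<subseteq> rid c"
        by simp
      with r(1) have "\<exists>r\<in>?B. rid r \<subseteq> rid c"
        by (rule bexI[rotated])
      with c(1) have "c \<in> {b \<in> carrier P. \<exists>r\<in>?B. rid r \<subseteq> rid b}"
        by simp
      then show "e \<in> ?\<eta>"
        unfolding c(2) by (rule imageI)
    qed
    ultimately have "?\<eta> = \<xi>"
      using assms(1) by (simp add: ultrafilters_def)
    moreover obtain r where r: "r \<in> ?B" "rid r = rid \<one> \<inter> rid a"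
      by (rule bexE[OF lcm[OF one_closed one]])
    then have "rid r \<subseteq> rid a"
      by simp
    with r(1) have "\<exists>r\<in>?B. rid r \<subseteq> rid a"
      by (rule bexI[rotated])
    then have "a \<in> {b \<in> carrier P. \<exists>r\<in>?B. rid r \<subseteq> rid b}"
      using assms(2) by simp
    then have "proj a \<in> ?\<eta>"
      by (rule imageI)
    ultimately show False
      using assms(3) by simp
  qed
qed

text \<open>An ultrafilter that contains \<open>[k,k]\<close> but none of the finitely many \<open>[f,f]\<close> contains, for each \<open>f\<close>, an
  ideal disjoint from \<open>fP\<close>. Intersecting these with \<open>kP\<close> gives a subideal of \<open>kP\<close> that meets no \<open>fP\<close>.\<close>

lemma ultrafilter_finite_cover:
  assumes "\<xi> \<in> ultrafilters S" "k \<in> carrier P" "proj k \<in> \<xi>" "finite F" "F \<subseteq> carrier P"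
    and cover: "\<And>c. \<lbrakk>c \<in> carrier P; rid c \<subseteq> rid k\<rbrakk> \<Longrightarrow> \<exists>f\<in>F. rid f \<inter> rid c \<noteq> {}"
  shows "\<exists>f\<in>F. proj f \<in> \<xi>"
proof (rule ccontr)
  assume none: "\<not> (\<exists>f\<in>F. proj f \<in> \<xi>)"
  have filt: "\<xi> \<in> filters S"
    using assms(1) by (simp add: ultrafilters_def)
  have "\<exists>c\<in>carrier P. proj c \<in> \<xi> \<and> rid c \<subseteq> rid k \<and> (\<forall>f\<in>F'. rid f \<inter> rid c = {})" if "F' \<subseteq> F" for F'
    using finite_subset[OF that assms(4)] that
  proof (induction F' rule: finite_induct)
    case empty
    then show ?case
      using assms by blast
  next
    case (insert f F')
    then obtain c where c: "c \<in> carrier P" "proj c \<in> \<xi>" "rid c \<subseteq> rid k" "\<forall>f\<in>F'. rid f \<inter> rid c = {}"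
      by blast
    have "f \<in> carrier P" "proj f \<notin> \<xi>"
      using insert.prems assms(5) none by blast+
    then obtain d where d: "d \<in> carrier P" "proj d \<in> \<xi>" "rid d \<inter> rid f = {}"
      using ultrafilter_excludes[OF assms(1)] by metis
    obtain r where r: "r \<in> carrier P" "rid c \<inter> rid d = rid r" "proj r \<in> \<xi>"
      using filter_meet[OF filt c(2) d(2) c(1) d(1)] by metis
    have "\<forall>g\<in>insert f F'. rid g \<inter> rid r = {}"
      using r(2) c(4) d(3) by blast
    moreover have "rid r \<subseteq> rid k"
      using r(2) c(3) by blast
    ultimately show ?case
      using r by blast
  qed
  then obtain c where "c \<in> carrier P" "rid c \<subseteq> rid k" "\<forall>f\<in>F. rid f \<inter> rid c = {}"
    by blast
  then show False
    using cover[of c] by simp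
qed

section \<open>The space of tight filters\<close>

lemma topspace_filter_space: "topspace (filter_space S) = filters S"
  by (auto simp: filter_space_def topspace_pullback_topology)

lemma continuous_map_membership:
  assumes "e \<in> idems S"
  shows "continuous_map (filter_space S) (discrete_topology UNIV) (\<lambda>\<xi>. e \<in> \<xi>)"
proof -
  have "(\<lambda>h. h e) \<circ> (\<lambda>\<xi>. \<lambda>e\<in>idems S. e \<in> \<xi>) = (\<lambda>\<xi>. e \<in> \<xi>)"
    using assms by auto
  then show ?thesis
    using continuous_map_pullback[OF continuous_map_product_projection[OF assms]]
    unfolding filter_space_def by metis
qed

lemma clopen_membership:
  assumes "e \<in> idems S"
  shows "openin (filter_space S) {\<xi> \<in> filters S. e \<in> \<xi>}"
    and "closedin (filter_space S) {\<xi> \<in> filters S. e \<in> \<xi>}"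
  using openin_continuous_map_preimage[OF continuous_map_membership[OF assms], of "{True}"]
    closedin_continuous_map_preimage[OF continuous_map_membership[OF assms], of "{True}"]
  by (simp_all add: topspace_filter_space)

lemma Hausdorff_filter_space: "Hausdorff_space (filter_space S)"
  unfolding Hausdorff_space_def topspace_filter_space
proof (intro allI impI)
  fix \<xi> \<eta> assume *: "\<xi> \<in> filters S \<and> \<eta> \<in> filters S \<and> \<xi> \<noteq> \<eta>"
  then have "\<xi> \<subseteq> idems S" "\<eta> \<subseteq> idems S" "\<xi> \<noteq> \<eta>"
    unfolding filters_iff by simp_all
  then obtain e where e: "e \<in> idems S" "e \<in> \<xi> \<longleftrightarrow> e \<notin> \<eta>"
    by blast
  let ?U = "{\<xi> \<in> filters S. e \<in> \<xi>}"
  have "openin (filter_space S) ?U" "openin (filter_space S) (filters S - ?U)"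
    using clopen_membership[OF e(1)] by (auto simp: closedin_def topspace_filter_space)
  then show "\<exists>U V. openin (filter_space S) U \<and> openin (filter_space S) V \<and> \<xi> \<in> U \<and> \<eta> \<in> V \<and> disjnt U V"
    using * e(2) by (cases "e \<in> \<xi>") (auto simp: disjnt_def)
qed

text \<open>The characteristic functions of filters form a closed subset of a product of finite spaces. Since
  the semigroup has an identity, being nonempty is the closed condition of containing it.\<close>

lemma compact_filter_space: "compact_space (filter_space S)"
proof -
  define X where "X = product_topology (\<lambda>_. discrete_topology (UNIV :: bool set)) (idems S)"
  define char where "char = (\<lambda>\<xi>. \<lambda>e\<in>idems S. e \<in> \<xi>)"
  define K where "K = {h \<in> topspace X. \<not> h {} \<and> h (proj \<one>) \<and>
     (\<forall>e\<in>idems S. \<forall>f\<in>idems S. h e \<longrightarrow> h f \<longrightarrow> h (e \<cdot>\<^bsub>S\<^esub> f)) \<and>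
     (\<forall>e\<in>idems S. \<forall>f\<in>idems S. nat_le S e f \<longrightarrow> h e \<longrightarrow> h f)}"
  have clopen: "closedin X {h \<in> topspace X. h e}" "closedin X {h \<in> topspace X. \<not> h e}"
    if "e \<in> idems S" for e
    using closedin_continuous_map_preimage[OF continuous_map_product_projection[OF that], of _ "{True}"]
      closedin_continuous_map_preimage[OF continuous_map_product_projection[OF that], of _ "{False}"]
    unfolding X_def by (simp_all del: topspace_product_topology)
  have mult: "closedin X {h \<in> topspace X. h e \<longrightarrow> h f \<longrightarrow> h (e \<cdot>\<^bsub>S\<^esub> f)}"
    if "e \<in> idems S" "f \<in> idems S" for e f
  proof -
    have "{h \<in> topspace X. h e \<longrightarrow> h f \<longrightarrow> h (e \<cdot>\<^bsub>S\<^esub> f)} =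
      {h \<in> topspace X. \<not> h e} \<union> {h \<in> topspace X. \<not> h f} \<union> {h \<in> topspace X. h (e \<cdot>\<^bsub>S\<^esub> f)}"
      by blast
    then show ?thesis
      using that idem_prod_closed[OF that] by (simp add: clopen closedin_Un)
  qed
  have up: "closedin X {h \<in> topspace X. nat_le S e f \<longrightarrow> h e \<longrightarrow> h f}"
    if "e \<in> idems S" "f \<in> idems S" for e f
  proof (cases "nat_le S e f")
    case True
    then have "{h \<in> topspace X. nat_le S e f \<longrightarrow> h e \<longrightarrow> h f} =
      {h \<in> topspace X. \<not> h e} \<union> {h \<in> topspace X. h f}"
      by blast
    then show ?thesis
      using that by (simp add: clopen closedin_Un)
  qed simp
  have "closedin X K"
    unfolding K_def
    by (intro closedin_Collect_conj closedin_Collect_ball clopen mult up zero_idem proj_idem one_closed)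
  moreover have "compact_space X"
    unfolding X_def by (simp add: compact_space_product_topology compact_space_discrete_topology)
  ultimately have K: "compact_space (subtopology X K)"
    by (simp add: closedin_compact_space compact_space_subtopology)
  have cont: "continuous_map (subtopology X K) (filter_space S) (\<lambda>h. {e \<in> idems S. h e})"
    unfolding filter_space_def X_def[symmetric] char_def[symmetric]
  proof (rule continuous_map_pullback')
    have "char {e \<in> idems S. h e} = h" if "h \<in> K" for h
    proof
      fix e
      have "h \<in> extensional (idems S)"
        using that unfolding K_def X_def by (simp add: PiE_def)
      then show "char {e \<in> idems S. h e} e = h e"
        by (simp add: char_def extensional_def)
    qed
    then show "continuous_map (subtopology X K) X (char \<circ> (\<lambda>h. {e \<in> idems S. h e}))"
      by (intro continuous_map_eq[OF continuous_map_from_subtopology[OF continuous_map_id]]) auto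
    show "topspace (subtopology X K) \<subseteq> (\<lambda>h. {e \<in> idems S. h e}) -` filters S"
    proof
      fix h assume "h \<in> topspace (subtopology X K)"
      then have "h \<in> K"
        by simp
      then have "{e \<in> idems S. h e} \<in> filters S"
        unfolding filters_iff K_def by (simp add: proj_idem idem_prod_closed)
      then show "h \<in> (\<lambda>h. {e \<in> idems S. h e}) -` filters S"
        by simp
    qed
  qed
  have onto: "(\<lambda>h. {e \<in> idems S. h e}) ` topspace (subtopology X K) = topspace (filter_space S)"
  proof
    show "(\<lambda>h. {e \<in> idems S. h e}) ` topspace (subtopology X K) \<subseteq> topspace (filter_space S)"
      using cont by (rule continuous_map_image_subset_topspace)
    show "topspace (filter_space S) \<subseteq> (\<lambda>h. {e \<in> idems S. h e}) ` topspace (subtopology X K)"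
    proof
      fix \<xi> assume "\<xi> \<in> topspace (filter_space S)"
      then have \<xi>: "\<xi> \<in> filters S"
        by (simp add: topspace_filter_space)
      then have "char \<xi> \<in> K"
        unfolding filters_iff K_def X_def char_def
        by (simp add: proj_idem zero_idem idem_prod_closed)
      moreover have "{e \<in> idems S. char \<xi> e} = \<xi>"
        using \<xi> unfolding filters_iff char_def by auto
      ultimately show "\<xi> \<in> (\<lambda>h. {e \<in> idems S. h e}) ` topspace (subtopology X K)"
        by (intro image_eqI[of _ _ "char \<xi>"]) (simp_all add: K_def)
    qed
  qed
  show ?thesis
    using image_compactin[OF K[unfolded compact_space_def] cont] unfolding onto compact_space_def .
qed

lemma tight_filters_subset: "tight_filters S \<subseteq> filters S"
  unfolding tight_filters_def using closure_of_subset_topspace topspace_filter_space by metis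

lemma topspace_tight_space: "topspace (tight_space S) = tight_filters S"
  using tight_filters_subset by (auto simp: tight_space_def topspace_filter_space)

lemma ultrafilters_subset_tight: "ultrafilters S \<subseteq> tight_filters S"
  unfolding tight_filters_def
  by (intro closure_of_subset) (auto simp: ultrafilters_def topspace_filter_space)

lemma compact_tight_space: "compact_space (tight_space S)"
  unfolding tight_space_def
  by (intro compact_space_subtopology closedin_compact_space compact_filter_space)
    (simp add: tight_filters_def)

lemma Hausdorff_tight_space: "Hausdorff_space (tight_space S)"
  unfolding tight_space_def by (intro Hausdorff_space_subtopology Hausdorff_filter_space)

lemma D_set_eq: "D_set S e = tight_filters S \<inter> {\<xi> \<in> filters S. e \<in> \<xi>}"
  unfolding D_set_def using tight_filters_subset by blast

lemma clopen_D_set: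
  assumes "e \<in> idems S"
  shows "openin (tight_space S) (D_set S e)" "closedin (tight_space S) (D_set S e)"
  unfolding D_set_eq tight_space_def using clopen_membership[OF assms]
  by (auto simp: openin_subtopology closedin_subtopology)

lemma D_set_one: "D_set S (proj \<one>) = tight_filters S"
  using tight_filters_subset filters_iff unfolding D_set_def by blast

lemma D_set_zero: "D_set S {} = {}"
  using tight_filters_subset filters_iff unfolding D_set_def by blast

text \<open>Both sides are clopen, so it suffices to compare them on the dense set of ultrafilters.\<close>

lemma D_set_finite_cover:
  assumes "k \<in> carrier P" "finite F" "F \<subseteq> carrier P"
    and cover: "\<And>c. \<lbrakk>c \<in> carrier P; rid c \<subseteq> rid k\<rbrakk> \<Longrightarrow> \<exists>f\<in>F. rid f \<inter> rid c \<noteq> {}"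
  shows "D_set S (proj k) \<subseteq> (\<Union>f\<in>F. D_set S (proj f))"
proof -
  let ?C = "(filters S - {\<xi> \<in> filters S. proj k \<in> \<xi>}) \<union> (\<Union>f\<in>F. {\<xi> \<in> filters S. proj f \<in> \<xi>})"
  have "closedin (filter_space S) (filters S - {\<xi> \<in> filters S. proj k \<in> \<xi>})"
    using closedin_diff[OF closedin_topspace clopen_membership(1)[OF proj_idem[OF assms(1)]]]
    by (simp add: topspace_filter_space)
  moreover have "closedin (filter_space S) (\<Union>f\<in>F. {\<xi> \<in> filters S. proj f \<in> \<xi>})"
    using assms(2,3) clopen_membership(2)[OF proj_idem] by (intro closedin_Union) auto
  ultimately have "closedin (filter_space S) ?C"
    by (rule closedin_Un)
  moreover have "ultrafilters S \<subseteq> ?C"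
  proof
    fix \<xi> assume \<xi>: "\<xi> \<in> ultrafilters S"
    then have "\<xi> \<in> filters S"
      by (simp add: ultrafilters_def)
    moreover have "\<exists>f\<in>F. proj f \<in> \<xi>" if "proj k \<in> \<xi>"
      using ultrafilter_finite_cover[OF \<xi> assms(1) that assms(2,3) cover] by blast
    ultimately show "\<xi> \<in> ?C"
      by blast
  qed
  ultimately have "tight_filters S \<subseteq> ?C"
    unfolding tight_filters_def by (intro closure_of_minimal)
  then show ?thesis
    unfolding D_set_def by blast
qed

section \<open>Germs\<close>

lemma germ_pairs_frac:
  assumes "p \<in> carrier P" "q \<in> carrier P"
  shows "(frac p q, x) \<in> germ_pairs S \<longleftrightarrow> x \<in> D_set S (proj q)"
  using assms by (simp add: germ_pairs_def frac_closed star_prod_frac)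

text \<open>Zero has an empty domain, so every germ comes from a fraction.\<close>

lemma germ_pairs_E:
  assumes "(s, x) \<in> germ_pairs S"
  obtains p q where "p \<in> carrier P" "q \<in> carrier P" "s = frac p q" "x \<in> D_set S (proj q)"
proof -
  have s: "s \<in> carrier S" "x \<in> D_set S (star S s \<cdot>\<^bsub>S\<^esub> s)"
    using assms by (simp_all add: germ_pairs_def)
  then have "s \<noteq> {}"
    by (metis D_set_zero empty_iff prod_zero(2))
  then obtain p q where "p \<in> carrier P" "q \<in> carrier P" "s = frac p q"
    using s(1) by (metis carrier_S)
  with that s(2) show ?thesis
    by (simp add: star_prod_frac)
qed

text \<open>An idempotent \<open>[a,a]\<close> in \<open>x\<close> that equalizes the fractions restricts the partial maps \<open>q m \<mapsto> p m\<close> and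
  \<open>d n \<mapsto> c n\<close> to one common map, whose domain is generated by some \<open>q m = d n\<close>. Conversely two such
  maps that agree at one point agree on the whole ideal generated by it, so the idempotent of that
  ideal equalizes the fractions.\<close>

lemma germ_rel_frac:
  assumes [simp]: "p \<in> carrier P" "q \<in> carrier P" "c \<in> carrier P" "d \<in> carrier P"
    and x: "x \<in> D_set S (proj q)" "y \<in> D_set S (proj d)"
  shows "((frac p q, x), (frac c d, y)) \<in> germ_rel S \<longleftrightarrow>
    x = y \<and> (\<exists>m\<in>carrier P. \<exists>n\<in>carrier P. q \<otimes> m = d \<otimes> n \<and> p \<otimes> m = c \<otimes> n \<and> proj (q \<otimes> m) \<in> x)"
    (is "?L \<longleftrightarrow> ?R")
proof
  assume ?L
  then obtain e where "x = y" and e: "e \<in> idems S" "x \<in> D_set S e"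
    "frac p q \<cdot>\<^bsub>S\<^esub> e = frac c d \<cdot>\<^bsub>S\<^esub> e"
    by (auto simp: germ_rel_def)
  have filt: "x \<in> filters S"
    using x(1) tight_filters_subset by (auto simp: D_set_def)
  have in_x: "e \<in> x" "proj q \<in> x" "proj d \<in> x"
    using x \<open>x = y\<close> e(2) by (simp_all add: D_set_def)
  then obtain a where a [simp]: "a \<in> carrier P" and e_eq: "e = proj a"
    using filter_elements[OF filt] by metis
  have "proj a \<in> x"
    using in_x e_eq by simp
  obtain r where r [simp]: "r \<in> carrier P" and r': "rid q \<inter> rid a = rid r" "proj r \<in> x"
    using filter_meet[OF filt in_x(2) \<open>proj a \<in> x\<close>] by auto
  obtain t where t [simp]: "t \<in> carrier P" and t': "rid d \<inter> rid a = rid t" "proj t \<in> x"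
    using filter_meet[OF filt in_x(3) \<open>proj a \<in> x\<close>] by auto
  have "r \<in> rid q" "r \<in> rid a" "t \<in> rid d" "t \<in> rid a"
    using r' t' self_mem_rid[OF r] self_mem_rid[OF t] by blast+
  then obtain m m' n n' where [simp]: "m \<in> carrier P" "m' \<in> carrier P" "n \<in> carrier P" "n' \<in> carrier P"
    and rt: "q \<otimes> m = r" "a \<otimes> m' = r" "d \<otimes> n = t" "a \<otimes> n' = t"
    unfolding mem_rid by metis
  have "frac p q \<cdot>\<^bsub>S\<^esub> e = frac (p \<otimes> m) r" "frac c d \<cdot>\<^bsub>S\<^esub> e = frac (c \<otimes> n) t"
    unfolding e_eq using frac_prod[of p q a a m m' r] frac_prod[of c d a a n n' t] r' t' rt by simp_all
  then obtain u where u: "u \<in> Units P" "c \<otimes> n \<otimes> u = p \<otimes> m" "t \<otimes> u = r"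
    using e(3) frac_eq_iff[of "p \<otimes> m" r "c \<otimes> n" t] by auto
  have [simp]: "u \<in> carrier P"
    using u(1) by (rule Units_closed)
  have "q \<otimes> m = d \<otimes> (n \<otimes> u)" "p \<otimes> m = c \<otimes> (n \<otimes> u)"
    using u rt by (simp_all add: m_assoc[symmetric])
  moreover have "proj (q \<otimes> m) \<in> x"
    using rt r' by simp
  moreover have "m \<in> carrier P" "n \<otimes> u \<in> carrier P"
    by simp_all
  ultimately show ?R
    using \<open>x = y\<close> by blast
next
  assume ?R
  then obtain m n where "x = y" and m [simp]: "m \<in> carrier P" and n [simp]: "n \<in> carrier P"
    and mn: "q \<otimes> m = d \<otimes> n" "p \<otimes> m = c \<otimes> n" "proj (q \<otimes> m) \<in> x"
    by blast
  have "frac p q \<cdot>\<^bsub>S\<^esub> proj (q \<otimes> m) = frac c d \<cdot>\<^bsub>S\<^esub> proj (q \<otimes> m)"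
    using frac_proj_prod[of p q m] frac_proj_prod[of c d n] mn by simp
  moreover have "x \<in> D_set S (proj (q \<otimes> m))"
    using x(1) mn(3) by (simp add: D_set_def)
  moreover have "proj (q \<otimes> m) \<in> idems S"
    by (simp add: proj_idem)
  moreover have "(frac p q, x) \<in> germ_pairs S" "(frac c d, y) \<in> germ_pairs S"
    using x by (simp_all add: germ_pairs_frac)
  ultimately show ?L
    unfolding germ_rel_def using \<open>x = y\<close> by blast
qed

text \<open>For transitivity, intersect the two ideals on which the partial maps agree pairwise. Left
  cancellation by the middle denominator \<open>d\<close> matches the parameters \<open>n i\<close> and \<open>n' j\<close> of the middle map.\<close>

lemma equiv_germ_rel: "equiv (germ_pairs S) (germ_rel S)"
proof (rule equivI)
  show "germ_rel S \<subseteq> germ_pairs S \<times> germ_pairs S"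
    by (auto simp: germ_rel_def)
  show "refl_on (germ_pairs S) (germ_rel S)"
  proof (rule refl_onI)
    fix v assume v: "v \<in> germ_pairs S"
    obtain s x where sx: "v = (s, x)"
      by (cases v)
    then obtain p q where "p \<in> carrier P" "q \<in> carrier P" "s = frac p q" "x \<in> D_set S (proj q)"
      using v germ_pairs_E by metis
    moreover from this have "proj (q \<otimes> \<one>) \<in> x"
      by (simp add: D_set_def)
    ultimately show "(v, v) \<in> germ_rel S"
      unfolding sx using germ_rel_frac[of p q p q x x] one_closed by metis
  qed
  show "sym (germ_rel S)"
    by (rule symI) (auto simp: germ_rel_def)
  show "trans (germ_rel S)"
  proof (rule transI)
    fix v w z assume vw: "(v, w) \<in> germ_rel S" and wz: "(w, z) \<in> germ_rel S"
    obtain s x where v: "v = (s, x)"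
      by (cases v)
    obtain t where w: "w = (t, x)"
      using vw unfolding v germ_rel_def by blast
    obtain t' where z: "z = (t', x)"
      using wz unfolding w germ_rel_def by blast
    have "(s, x) \<in> germ_pairs S" "(t, x) \<in> germ_pairs S" "(t', x) \<in> germ_pairs S"
      using vw wz unfolding v w z germ_rel_def by blast+
    then obtain p q c d g h where
      pq [simp]: "p \<in> carrier P" "q \<in> carrier P" and 1: "s = frac p q" "x \<in> D_set S (proj q)" and
      cd [simp]: "c \<in> carrier P" "d \<in> carrier P" and 2: "t = frac c d" "x \<in> D_set S (proj d)" and
      gh [simp]: "g \<in> carrier P" "h \<in> carrier P" and 3: "t' = frac g h" "x \<in> D_set S (proj h)"
      by (elim germ_pairs_E) blast
    obtain m n where [simp]: "m \<in> carrier P" "n \<in> carrier P"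
      and mn: "q \<otimes> m = d \<otimes> n" "p \<otimes> m = c \<otimes> n" "proj (q \<otimes> m) \<in> x"
      using vw unfolding v w 1 2 germ_rel_frac[OF pq cd 1(2) 2(2)] by blast
    obtain n' k where [simp]: "n' \<in> carrier P" "k \<in> carrier P"
      and nk: "d \<otimes> n' = h \<otimes> k" "c \<otimes> n' = g \<otimes> k" "proj (d \<otimes> n') \<in> x"
      using wz unfolding w z 2 3 germ_rel_frac[OF cd gh 2(2) 3(2)] by blast
    have filt: "x \<in> filters S"
      using 1(2) tight_filters_subset by (auto simp: D_set_def)
    obtain r where r [simp]: "r \<in> carrier P" and r': "rid (q \<otimes> m) \<inter> rid (d \<otimes> n') = rid r" "proj r \<in> x"
      using filter_meet[OF filt mn(3) nk(3)] by auto
    have "r \<in> rid (q \<otimes> m)" "r \<in> rid (d \<otimes> n')"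
      using r' self_mem_rid[OF r] by blast+
    then obtain i j where [simp]: "i \<in> carrier P" "j \<in> carrier P"
      and ij: "r = q \<otimes> m \<otimes> i" "r = d \<otimes> n' \<otimes> j"
      unfolding mem_rid by blast
    have "d \<otimes> (n \<otimes> i) = d \<otimes> (n' \<otimes> j)"
      using ij mn(1) by (simp add: m_assoc)
    then have ni: "n \<otimes> i = n' \<otimes> j"
      using left_cancel[of d "n \<otimes> i" "n' \<otimes> j"] by simp
    have "p \<otimes> (m \<otimes> i) = (c \<otimes> n) \<otimes> i"
      unfolding mn(2)[symmetric] by (simp add: m_assoc)
    also have "\<dots> = (c \<otimes> n') \<otimes> j"
      using ni by (simp add: m_assoc)
    also have "\<dots> = g \<otimes> (k \<otimes> j)"
      unfolding nk(2) by (simp add: m_assoc)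
    finally have "p \<otimes> (m \<otimes> i) = g \<otimes> (k \<otimes> j)" .
    moreover have "q \<otimes> (m \<otimes> i) = r"
      unfolding ij(1) by (simp add: m_assoc)
    moreover have "h \<otimes> (k \<otimes> j) = r"
      unfolding ij(2) nk(1) by (simp add: m_assoc)
    moreover have "m \<otimes> i \<in> carrier P" "k \<otimes> j \<in> carrier P"
      by simp_all
    ultimately show "(v, z) \<in> germ_rel S"
      unfolding v z 1 3 germ_rel_frac[OF pq gh 1(2) 3(2)] using r'(2) by metis
  qed
qed

lemma germ_eq_iff:
  assumes "p \<in> carrier P" "q \<in> carrier P" "c \<in> carrier P" "d \<in> carrier P"
    and "x \<in> D_set S (proj q)" "y \<in> D_set S (proj d)"
  shows "germ S (frac p q) x = germ S (frac c d) y \<longleftrightarrow>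
    x = y \<and> (\<exists>m\<in>carrier P. \<exists>n\<in>carrier P. q \<otimes> m = d \<otimes> n \<and> p \<otimes> m = c \<otimes> n \<and> proj (q \<otimes> m) \<in> x)"
proof -
  have "germ S (frac p q) x = germ S (frac c d) y \<longleftrightarrow> ((frac p q, x), (frac c d, y)) \<in> germ_rel S"
    unfolding germ_def
    by (rule eq_equiv_class_iff[OF equiv_germ_rel]) (use assms in \<open>simp_all add: germ_pairs_frac\<close>)
  then show ?thesis
    unfolding germ_rel_frac[OF assms] .
qed

section \<open>The topology of the groupoid of germs\<close>

abbreviation germ_space :: "((('a \<times> 'a) set \<times> ('a \<times> 'a) set set) set) topology" where
  "germ_space \<equiv> arrows (tight_groupoid S)"

text \<open>The basic open sets coming from zero are empty, so only fractions matter.\<close>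

lemma germ_space_eq:
  "germ_space = topology_generated_by
    {germ S (frac p q) ` U | p q U. p \<in> carrier P \<and> q \<in> carrier P \<and> U \<subseteq> D_set S (proj q) \<and>
       openin (tight_space S) U}"
  (is "_ = topology_generated_by ?B")
proof -
  let ?C = "{germ S s ` U | s U. s \<in> carrier S \<and> U \<subseteq> D_set S (star S s \<cdot>\<^bsub>S\<^esub> s) \<and> openin (tight_space S) U}"
  have "?C \<subseteq> ?B"
  proof
    fix V assume "V \<in> ?C"
    then obtain s U where V: "V = germ S s ` U" and s: "s \<in> carrier S"
      and U: "U \<subseteq> D_set S (star S s \<cdot>\<^bsub>S\<^esub> s)" "openin (tight_space S) U"
      by blast
    show "V \<in> ?B"
    proof (cases "s = {}")
      case True
      then have "U = {}"
        using U(1) D_set_zero by simp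
      then have "V = germ S (frac \<one> \<one>) ` {}"
        using V by simp
      then show ?thesis
        by (intro CollectI exI[of _ \<one>] exI[of _ "{}"]) simp
    next
      case False
      then obtain p q where pq: "p \<in> carrier P" "q \<in> carrier P" "s = frac p q"
        using s by (metis carrier_S)
      then have "U \<subseteq> D_set S (proj q)"
        using U(1) star_prod_frac by simp
      with pq U(2) V show ?thesis
        by (intro CollectI exI[of _ p] exI[of _ q] exI[of _ U]) simp
    qed
  qed
  moreover have "?B \<subseteq> ?C"
  proof
    fix V assume "V \<in> ?B"
    then obtain p q U where V: "V = germ S (frac p q) ` U" and pq: "p \<in> carrier P" "q \<in> carrier P"
      and U: "U \<subseteq> D_set S (proj q)" "openin (tight_space S) U"
      by blast
    then have "U \<subseteq> D_set S (star S (frac p q) \<cdot>\<^bsub>S\<^esub> frac p q)" "frac p q \<in> carrier S"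
      by (simp_all add: star_prod_frac frac_closed)
    with V U(2) show "V \<in> ?C"
      by (intro CollectI exI[of _ "frac p q"] exI[of _ U]) simp
  qed
  ultimately show ?thesis
    by (simp add: tight_groupoid_def)
qed

lemma openin_germ_space:
  assumes "p \<in> carrier P" "q \<in> carrier P" "U \<subseteq> D_set S (proj q)" "openin (tight_space S) U"
  shows "openin germ_space (germ S (frac p q) ` U)"
  unfolding germ_space_eq using assms
  by (intro topology_generated_by_Basis CollectI exI[of _ p] exI[of _ q] exI[of _ U]) simp

lemma topspace_germ_space_E:
  assumes "g \<in> topspace germ_space"
  obtains p q x where "p \<in> carrier P" "q \<in> carrier P" "x \<in> D_set S (proj q)" "g = germ S (frac p q) x"
  using assms unfolding germ_space_eq topology_generated_by_topspace by blast

text \<open>The preimage of a basic open set \<open>{[t,y] | y \<in> U}\<close> is the part of \<open>U\<close> where the two germs coincide, and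
  that locus is a union of open sets \<open>D e\<close>, one for each point where the two partial maps agree.\<close>

lemma continuous_map_germ:
  assumes p: "p \<in> carrier P"
  shows "continuous_map (tight_space S) germ_space (germ S (frac p \<one>))"
  unfolding germ_space_eq
proof (rule continuous_on_generated_topo)
  fix V assume "V \<in> {germ S (frac p q) ` U | p q U. p \<in> carrier P \<and> q \<in> carrier P \<and>
    U \<subseteq> D_set S (proj q) \<and> openin (tight_space S) U}"
  then obtain c d U where V: "V = germ S (frac c d) ` U" and cd: "c \<in> carrier P" "d \<in> carrier P"
    and U: "U \<subseteq> D_set S (proj d)" "openin (tight_space S) U"
    by blast
  let ?N = "{n \<in> carrier P. p \<otimes> (d \<otimes> n) = c \<otimes> n}"
  have eq: "germ S (frac p \<one>) x = germ S (frac c d) y \<longleftrightarrow>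
      x = y \<and> (\<exists>n\<in>?N. y \<in> D_set S (proj (d \<otimes> n)))"
    if "x \<in> tight_filters S" "y \<in> U" for x y
  proof -
    have y: "y \<in> D_set S (proj d)" and x: "x \<in> D_set S (proj \<one>)"
      using that U(1) D_set_one by auto
    show ?thesis
      unfolding germ_eq_iff[OF p one_closed cd x y] using y cd by (auto simp: D_set_def)
  qed
  have "germ S (frac p \<one>) -` V \<inter> topspace (tight_space S) = U \<inter> (\<Union>n\<in>?N. D_set S (proj (d \<otimes> n)))"
  proof (intro equalityI subsetI)
    fix x assume "x \<in> germ S (frac p \<one>) -` V \<inter> topspace (tight_space S)"
    then obtain y where "x \<in> tight_filters S" "y \<in> U" "germ S (frac p \<one>) x = germ S (frac c d) y"
      unfolding V topspace_tight_space by blast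
    then show "x \<in> U \<inter> (\<Union>n\<in>?N. D_set S (proj (d \<otimes> n)))"
      using eq[of x y] by simp
  next
    fix x assume x: "x \<in> U \<inter> (\<Union>n\<in>?N. D_set S (proj (d \<otimes> n)))"
    then have "x \<in> tight_filters S" "x \<in> U"
      by (auto simp: D_set_def)
    then show "x \<in> germ S (frac p \<one>) -` V \<inter> topspace (tight_space S)"
      unfolding V topspace_tight_space using x eq[of x x] by simp
  qed
  moreover have "openin (tight_space S) (\<Union>n\<in>?N. D_set S (proj (d \<otimes> n)))"
    using cd by (intro openin_Union) (auto intro!: clopen_D_set(1) proj_idem)
  ultimately show "openin (tight_space S) (germ S (frac p \<one>) -` V \<inter> topspace (tight_space S))"
    using U(2) by (simp add: openin_Int)
next
  have "germ S (frac p \<one>) ` tight_filters S \<in> {germ S (frac p q) ` U | p q U. p \<in> carrier P \<and> q \<in> carrier P \<and>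
    U \<subseteq> D_set S (proj q) \<and> openin (tight_space S) U}"
    using p D_set_one openin_topspace[of "tight_space S"] topspace_tight_space
    by (intro CollectI exI[of _ p] exI[of _ \<one>] exI[of _ "tight_filters S"]) simp
  then show "germ S (frac p \<one>) ` topspace (tight_space S) \<subseteq>
      \<Union>{germ S (frac p q) ` U | p q U. p \<in> carrier P \<and> q \<in> carrier P \<and>
        U \<subseteq> D_set S (proj q) \<and> openin (tight_space S) U}"
    unfolding topspace_tight_space by (rule Union_upper)
qed

section \<open>The Hausdorff property\<close>

definition condition_H :: bool where
  "condition_H \<longleftrightarrow> (\<forall>p\<in>carrier P. \<forall>q\<in>carrier P. (\<exists>b\<in>carrier P. p \<otimes> b = q \<otimes> b) \<longrightarrow>
      (\<exists>F. finite F \<and> F \<subseteq> carrier P \<and> (\<forall>f\<in>F. p \<otimes> f = q \<otimes> f) \<and>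
        (\<forall>b\<in>carrier P. p \<otimes> b = q \<otimes> b \<longrightarrow> (\<exists>f\<in>F. rid f \<inter> rid b \<noteq> {}))))"

text \<open>The bisections given by \<open>[p,1]\<close> and \<open>[q,1]\<close> agree exactly on the union of the sets \<open>D [m,m]\<close> with
  \<open>p m = q m\<close>. In a Hausdorff space this locus is closed, hence compact, and a finite subcover of
  it is the required \<open>F\<close>: an ultrafilter containing \<open>[b,b]\<close> lies in some \<open>D [f,f]\<close>, so \<open>fP\<close> meets \<open>bP\<close>.\<close>

lemma condition_H_if_Hausdorff:
  assumes "Hausdorff_space germ_space"
  shows condition_H
  unfolding condition_H_def
proof (intro ballI impI)
  fix p q assume p: "p \<in> carrier P" and q: "q \<in> carrier P"
  let ?M = "{m \<in> carrier P. p \<otimes> m = q \<otimes> m}"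
  let ?A = "\<Union>m\<in>?M. D_set S (proj m)"
  have eq: "germ S (frac p \<one>) x = germ S (frac q \<one>) x \<longleftrightarrow> x \<in> ?A" if "x \<in> tight_filters S" for x
  proof -
    have x: "x \<in> D_set S (proj \<one>)"
      using that D_set_one by simp
    show ?thesis
      unfolding germ_eq_iff[OF p one_closed q one_closed x x] using that by (auto simp: D_set_def)
  qed
  have "{x \<in> topspace (tight_space S). germ S (frac p \<one>) x = germ S (frac q \<one>) x} = ?A"
    unfolding topspace_tight_space using eq by (auto simp: D_set_def)
  then have "closedin (tight_space S) ?A"
    using closedin_continuous_maps_eq[OF assms continuous_map_germ[OF p] continuous_map_germ[OF q]] by simp
  then have "compactin (tight_space S) ?A"
    by (rule closedin_compact_space[OF compact_tight_space])
  moreover have "openin (tight_space S) U" if "U \<in> (\<lambda>m. D_set S (proj m)) ` ?M" for U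
    using that clopen_D_set(1)[OF proj_idem] by blast
  ultimately obtain \<F> where \<F>: "finite \<F>" "\<F> \<subseteq> (\<lambda>m. D_set S (proj m)) ` ?M" "?A \<subseteq> \<Union>\<F>"
    unfolding compactin_def by (metis (no_types, lifting) subset_refl)
  obtain F where F: "finite F" "F \<subseteq> ?M" "\<F> = (\<lambda>m. D_set S (proj m)) ` F"
    using finite_subset_image[OF \<F>(1,2)] by blast
  have "\<exists>f\<in>F. rid f \<inter> rid b \<noteq> {}" if b: "b \<in> carrier P" "p \<otimes> b = q \<otimes> b" for b
  proof -
    obtain \<xi> where \<xi>: "\<xi> \<in> ultrafilters S" "proj b \<in> \<xi>"
      using ultrafilter_exists[OF b(1)] .
    then have "\<xi> \<in> tight_filters S"
      using ultrafilters_subset_tight by blast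
    then have "\<xi> \<in> D_set S (proj b)"
      using \<xi>(2) by (simp add: D_set_def)
    then have "\<xi> \<in> ?A"
      using b by blast
    then obtain f where f: "f \<in> F" "\<xi> \<in> D_set S (proj f)"
      using \<F>(3) F(3) by blast
    have "proj f \<in> \<xi>" "f \<in> carrier P" "\<xi> \<in> filters S"
      using f F(2) \<xi>(1) by (auto simp: D_set_def ultrafilters_def)
    then obtain r where "r \<in> carrier P" "rid f \<inter> rid b = rid r"
      using filter_meet[of \<xi> f b] \<xi>(2) b(1) by metis
    then have "rid f \<inter> rid b \<noteq> {}"
      using self_mem_rid[of r] by blast
    then show ?thesis
      using f(1) by blast
  qed
  with F(1,2) show "\<exists>F. finite F \<and> F \<subseteq> carrier P \<and> (\<forall>f\<in>F. p \<otimes> f = q \<otimes> f) \<and>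
        (\<forall>b\<in>carrier P. p \<otimes> b = q \<otimes> b \<longrightarrow> (\<exists>f\<in>F. rid f \<inter> rid b \<noteq> {}))"
    by (intro exI[of _ F]) auto
qed

text \<open>Condition (H) reduces the union to the finitely many \<open>m\<close> in \<open>F\<close>: the solutions of \<open>p m = q m\<close> are closed
  under right multiplication, so every subideal of \<open>r m P\<close> meets some \<open>r f P\<close>, and the covering
  criterion for tight filters applies. Left translation by \<open>r\<close> keeps meeting ideals meeting.\<close>

lemma closedin_agreement:
  assumes condition_H and p: "p \<in> carrier P" and q: "q \<in> carrier P" and r: "r \<in> carrier P"
  shows "closedin (tight_space S) (\<Union>m\<in>{m \<in> carrier P. p \<otimes> m = q \<otimes> m}. D_set S (proj (r \<otimes> m)))"
proof (cases "\<exists>b\<in>carrier P. p \<otimes> b = q \<otimes> b")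
  case True
  obtain F where F: "finite F" "F \<subseteq> carrier P" "\<forall>f\<in>F. p \<otimes> f = q \<otimes> f"
    "\<forall>b\<in>carrier P. p \<otimes> b = q \<otimes> b \<longrightarrow> (\<exists>f\<in>F. rid f \<inter> rid b \<noteq> {})"
    using assms(1)[unfolded condition_H_def, rule_format, OF p q] True by metis
  have "D_set S (proj (r \<otimes> m)) \<subseteq> (\<Union>f\<in>(\<lambda>f. r \<otimes> f) ` F. D_set S (proj f))"
    if m: "m \<in> carrier P" "p \<otimes> m = q \<otimes> m" for m
  proof (rule D_set_finite_cover)
    show "r \<otimes> m \<in> carrier P" "finite ((\<lambda>f. r \<otimes> f) ` F)" "(\<lambda>f. r \<otimes> f) ` F \<subseteq> carrier P"
      using r m F by auto
    fix c assume "c \<in> carrier P" "rid c \<subseteq> rid (r \<otimes> m)"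
    then obtain y where y: "y \<in> carrier P" "c = r \<otimes> m \<otimes> y"
      using rid_subset_iff[of c "r \<otimes> m"] r m by (auto simp: mem_rid)
    then have c: "c = r \<otimes> (m \<otimes> y)"
      using r m by (simp add: m_assoc)
    have "p \<otimes> (m \<otimes> y) = q \<otimes> (m \<otimes> y)"
      using p q m y(1) by (simp add: m_assoc[symmetric])
    then obtain f where f: "f \<in> F" "rid f \<inter> rid (m \<otimes> y) \<noteq> {}"
      using F(4) m(1) y(1) by blast
    then have "rid (r \<otimes> f) \<inter> rid c \<noteq> {}"
      unfolding c using rid_translate_meet[of r f "m \<otimes> y"] r m(1) y(1) F(2) by blast
    then show "\<exists>f\<in>(\<lambda>f. r \<otimes> f) ` F. rid f \<inter> rid c \<noteq> {}"
      using f(1) by blast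
  qed
  then have "(\<Union>m\<in>{m \<in> carrier P. p \<otimes> m = q \<otimes> m}. D_set S (proj (r \<otimes> m))) =
      (\<Union>f\<in>F. D_set S (proj (r \<otimes> f)))"
    using F(2,3) by blast
  moreover have "closedin (tight_space S) (\<Union>f\<in>F. D_set S (proj (r \<otimes> f)))"
    using F(1,2) r by (intro closedin_Union) (auto intro!: clopen_D_set(2) proj_idem)
  ultimately show ?thesis
    by simp
next
  case False
  then have none: "{m \<in> carrier P. p \<otimes> m = q \<otimes> m} = {}"
    by blast
  show ?thesis
    unfolding none by simp
qed

text \<open>Germs at different points are separated by their sources. For two germs \<open>[p,q]\<close> and \<open>[c,d]\<close> at the
  same point, let \<open>r = q q' = d d'\<close> generate the common domain \<open>qP \<inter> dP\<close>. The partial maps send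
  \<open>r k\<close> to \<open>p q' k\<close> and \<open>c d' k\<close>, so the points where the germs coincide form the agreement set of
  \<open>p q'\<close> and \<open>c d'\<close> translated by \<open>r\<close>. It is closed, and the two germs are separated over its
  complement.\<close>

lemma Hausdorff_if_condition_H:
  assumes condition_H
  shows "Hausdorff_space germ_space"
  unfolding Hausdorff_space_def
proof (intro allI impI)
  fix g h assume gh: "g \<in> topspace germ_space \<and> h \<in> topspace germ_space \<and> g \<noteq> h"
  obtain p q x where p: "p \<in> carrier P" and q: "q \<in> carrier P" and x: "x \<in> D_set S (proj q)"
    and g: "g = germ S (frac p q) x"
    using gh topspace_germ_space_E by metis
  obtain c d y where c: "c \<in> carrier P" and d: "d \<in> carrier P" and y: "y \<in> D_set S (proj d)"
    and h: "h = germ S (frac c d) y"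
    using gh topspace_germ_space_E by metis
  have separate: "\<exists>G H. openin germ_space G \<and> openin germ_space H \<and> g \<in> G \<and> h \<in> H \<and> disjnt G H"
    if U: "openin (tight_space S) U" "x \<in> U" and V: "openin (tight_space S) V" "y \<in> V"
      and neq: "\<And>z. \<lbrakk>z \<in> U; z \<in> V; z \<in> D_set S (proj q); z \<in> D_set S (proj d)\<rbrakk> \<Longrightarrow>
        germ S (frac p q) z \<noteq> germ S (frac c d) z" for U V
  proof (intro exI conjI)
    let ?G = "germ S (frac p q) ` (U \<inter> D_set S (proj q))"
    let ?H = "germ S (frac c d) ` (V \<inter> D_set S (proj d))"
    show "openin germ_space ?G" "openin germ_space ?H"
      using U V p q c d by (auto intro!: openin_germ_space openin_Int clopen_D_set(1) proj_idem)
    show "g \<in> ?G" "h \<in> ?H"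
      using g h x y U V by blast+
    \<comment> \<open>Equal germs have equal sources, so it is enough to compare the two bisections pointwise.\<close>
    have "germ S (frac p q) z \<noteq> germ S (frac c d) z'"
      if z: "z \<in> U" "z \<in> D_set S (proj q)" "z' \<in> V" "z' \<in> D_set S (proj d)" for z z'
    proof
      assume eq: "germ S (frac p q) z = germ S (frac c d) z'"
      then have "z = z'"
        using germ_eq_iff[OF p q c d z(2,4)] by blast
      with eq z neq show False
        by metis
    qed
    then show "disjnt ?G ?H"
      unfolding disjnt_iff by blast
  qed
  show "\<exists>G H. openin germ_space G \<and> openin germ_space H \<and> g \<in> G \<and> h \<in> H \<and> disjnt G H"
  proof (cases "x = y")
    case False
    moreover have "x \<in> topspace (tight_space S)" "y \<in> topspace (tight_space S)"
      using x y by (simp_all add: topspace_tight_space D_set_def)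
    ultimately obtain U V where UV: "openin (tight_space S) U" "openin (tight_space S) V" "x \<in> U" "y \<in> V" "disjnt U V"
      using Hausdorff_tight_space unfolding Hausdorff_space_def by metis
    show ?thesis
      by (rule separate[OF UV(1,3,2,4)]) (use UV(5) in \<open>auto simp: disjnt_iff\<close>)
  next
    case True
    have x_tight: "x \<in> tight_filters S" and in_x: "proj q \<in> x" "proj d \<in> x"
      using x y True by (simp_all add: D_set_def)
    then have filt: "x \<in> filters S"
      using tight_filters_subset by blast
    obtain r where r: "r \<in> carrier P" "rid q \<inter> rid d = rid r" "proj r \<in> x"
      using filter_meet[OF filt in_x q d] .
    have "r \<in> rid q" "r \<in> rid d"
      using r self_mem_rid[OF r(1)] by blast+
    then obtain q' d' where q': "q' \<in> carrier P" "q \<otimes> q' = r" and d': "d' \<in> carrier P" "d \<otimes> d' = r"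
      unfolding mem_rid by metis
    let ?A = "\<Union>k\<in>{k \<in> carrier P. p \<otimes> q' \<otimes> k = c \<otimes> d' \<otimes> k}. D_set S (proj (r \<otimes> k))"
    have A: "z \<in> ?A" if eq: "germ S (frac p q) z = germ S (frac c d) z" and z: "z \<in> D_set S (proj q)" "z \<in> D_set S (proj d)" for z
    proof -
      obtain m n where m: "m \<in> carrier P" and n: "n \<in> carrier P"
        and mn: "q \<otimes> m = d \<otimes> n" "p \<otimes> m = c \<otimes> n" "proj (q \<otimes> m) \<in> z"
        using eq unfolding germ_eq_iff[OF p q c d z] by blast
      have "q \<otimes> m \<in> rid q \<inter> rid d"
        using mult_mem_rid[OF m, of q] mult_mem_rid[OF n, of d] mn(1) by simp
      then obtain k where k: "k \<in> carrier P" "q \<otimes> m = r \<otimes> k"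
        unfolding r(2) mem_rid by blast
      have "q \<otimes> m = q \<otimes> (q' \<otimes> k)" "d \<otimes> n = d \<otimes> (d' \<otimes> k)"
        using k mn(1) q' d' q d by (simp_all add: m_assoc[symmetric])
      then have "m = q' \<otimes> k" "n = d' \<otimes> k"
        using left_cancel q d m n q'(1) d'(1) k(1) by (meson m_closed)+
      then have "p \<otimes> q' \<otimes> k = c \<otimes> d' \<otimes> k"
        using mn(2) p c q'(1) d'(1) k(1) by (simp add: m_assoc)
      moreover have "z \<in> D_set S (proj (r \<otimes> k))"
        using mn(3) k(2) z(1) by (simp add: D_set_def)
      ultimately show ?thesis
        using k(1) by blast
    qed
    have "x \<notin> ?A"
    proof
      assume "x \<in> ?A"
      then obtain k where k: "k \<in> carrier P" "p \<otimes> q' \<otimes> k = c \<otimes> d' \<otimes> k" "proj (r \<otimes> k) \<in> x"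
        by (auto simp: D_set_def)
      have "q \<otimes> (q' \<otimes> k) = r \<otimes> k" "d \<otimes> (d' \<otimes> k) = r \<otimes> k" "p \<otimes> (q' \<otimes> k) = c \<otimes> (d' \<otimes> k)"
        using k(1,2) p q c d q' d' by (simp_all add: m_assoc[symmetric])
      then have "germ S (frac p q) x = germ S (frac c d) y"
        unfolding germ_eq_iff[OF p q c d x y] using True k(1,3) q'(1) d'(1) m_closed by metis
      then show False
        using gh g h by simp
    qed
    have "closedin (tight_space S) ?A"
      using closedin_agreement[OF assms, of "p \<otimes> q'" "c \<otimes> d'" r] p c q'(1) d'(1) r(1) by simp
    then have V: "openin (tight_space S) (topspace (tight_space S) - ?A)"
      by (simp add: closedin_def)
    have "x \<in> topspace (tight_space S) - ?A"
      using x_tight \<open>x \<notin> ?A\<close> by (simp add: topspace_tight_space)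
    then show ?thesis
      by (intro separate[OF V _ V]) (use True A in auto)
  qed
qed

end

theorem proposition4p1:
  fixes P :: "('a, 'm) monoid_scheme" (structure)
  assumes "right_LCM_monoid P"
    and "countable (carrier P)"
  shows "Hausdorff_groupoid (tight_groupoid (lcm_inverse_semigroup P)) \<longleftrightarrow>
    (\<forall>p\<in>carrier P. \<forall>q\<in>carrier P. (\<exists>b\<in>carrier P. p \<otimes> b = q \<otimes> b) \<longrightarrow>
      (\<exists>F. finite F \<and> F \<subseteq> carrier P \<and> (\<forall>f\<in>F. p \<otimes> f = q \<otimes> f) \<and>
        (\<forall>b\<in>carrier P. p \<otimes> b = q \<otimes> b \<longrightarrow>
          (\<exists>f\<in>F. principal_right_ideal P f \<inter> principal_right_ideal P b \<noteq> {}))))"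
proof -
  interpret right_LCM_monoid P
    by (fact assms(1))
  show ?thesis
    unfolding Hausdorff_groupoid_def condition_H_def[symmetric]
    using condition_H_if_Hausdorff Hausdorff_if_condition_H by blast
qed

end
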